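(* Let $\mathcal{X}$ and $\mathcal{Y}$ be bidemocratic bases of quasi-Banach spaces $\mathbb{X}$ and $\mathbb{Y}$ respectively. Suppose that \[ \varphi_u[\mathcal{X},\mathbb{X}](m)\approx\varphi_u[\mathcal{Y},\mathbb{Y}](m),\quad m\in\mathbb{N}. \] Then \[ g_m[\mathcal{X}\diamond\mathcal{Y},\mathbb{X}\oplus\mathbb{Y}]\approx\max\{g_m[\mathcal{X},\mathbb{X}],\,g_m[\mathcal{Y},\mathbb{Y}]\},\quad m\in\mathbb{N}. \] In particular, $\mathcal{X}\diamond\mathcal{Y}$ is quasi-greedy if and only if $\mathcal{X}$ and $\mathcal{Y}$ are quasi-greedy.
   Context: The scalar field $\mathbb{F}$ is $\mathbb{R}$ or $\mathbb{C}$. A quasi-Banach space is a vector space that is complete for a quasi-norm (a map satisfying the axioms of a norm except that the triangle inequality is replaced by $\|f+g\|\le\kappa(\|f\|+\|g\|)$ for some $\kappa\ge1$). A basis of a quasi-Banach space $\mathbb{X}$ (infinite-dimensional, separable) is a norm-bounded sequence $\mathcal{X}=(x_n)_{n=1}^\infty$ with $\overline{\operatorname{span}}(x_n\colon n\in\mathbb{N})=\mathbb{X}$ for which there is a (unique) norm-bounded sequence $\mathcal{X}^*=(x_n^* )_{n=1}^\infty$ in $\mathbb{X}^*$ with $x_n^*(x_k)=\delta_{n,k}$. Put $\varphi_u[\mathcal{X},\mathbb{X}](m)=\sup\{\|\sum_{n\in A}\varepsilon_nx_n\|\colon|A|\le m,\ |\varepsilon_n|=1\}$. With $\varphi(m)=\sup_{|A|\le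 m}\|\sum_{k\in A}x_k\|$ and $\varphi^*(m)=\sup_{|A|\le m}\|\sum_{k\in A}x_k^*\|$, the basis is bidemocratic if there is a constant $\Delta_b$ with $\varphi(m)\varphi^*(m)\le\Delta_b\,m$ for all $m\in\mathbb{N}$. A finite set $A\subseteq\mathbb{N}$ is a greedy set of $f\in\mathbb{X}$ if $|x_n^*(f)|\ge|x_k^*(f)|$ whenever $n\in A$, $k\notin A$. Put $S_A(f)=\sum_{n\in A}x_n^*(f)x_n$ and \[ \overline{g}_m[\mathcal{X},\mathbb{X}]=\sup\{\|S_A(f)\|\colon A\text{ greedy set of }f,\ \|f\|\le1,\ |A|=m\},\qquad g_m[\mathcal{X},\mathbb{X}]=\sup_{k\le m}\overline{g}_k[\mathcal{X},\mathbb{X}]. \] The basis is quasi-greedy if $\sup_mg_m<\infty$. $\mathbb{X}\oplus\mathbb{Y}$ is the Cartesian product with quasi-norm $\|(f,g)\|=\max\{\|f\|,\|g\|\}$. For $\mathcal{X}=(x_n)_{n=1}^\infty$ and $\mathcal{Y}=(y_n)_{n=1}^\infty$, $\mathcal{X}\diamond\mathcal{Y}=(z_n)_{n=1}^\infty$ is the sequence in $\mathbb{X}\oplus\mathbb{Y}$ given by $z_{2n-1}=\frac1{\sqrt2}(x_n,y_n)$, $z_{2n}=\frac1{\sqrt2}(x_n,-y_n)$; it is a basis of $\mathbb{X}\oplus\mathbb{Y}$ with dual basis $\mathcal{X}^*\diamond\mathcal{Y}^*$ (identifying $(\mathbb{X}\oplus\mathbb{Y})^*$ with $\mathbb{X}^*\oplus\mathbb{Y}^*$).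 $\alpha_m\approx\beta_m$ means $c\,\beta_m\le\alpha_m\le C\beta_m$ for some constants $0<c\le C<\infty$ independent of $m$. *)

theory Defs
  imports
    Complex_Main
    "HOL-Library.Product_Plus"
    "HOL-Library.Extended_Nonnegative_Real"
begin

text \<open>Scalar fields that are isometrically isomorphic to the real or to the complex numbers.\<close>

class real_or_complex = real_normed_field +
  assumes real_or_complex:
    "\<exists>h :: 'a \<Rightarrow> complex.
       (\<forall>a b. h (a + b) = h a + h b) \<and> (\<forall>a b. h (a * b) = h a * h b) \<and>
       (\<forall>r a. h (scaleR r a) = scaleR r (h a)) \<and> (\<forall>a. norm (h a) = norm a) \<and>
       (range h = \<real> \<or> range h = UNIV)"

instance real :: real_or_complex
proof
  show "\<exists>h :: real \<Rightarrow> complex.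
       (\<forall>a b. h (a + b) = h a + h b) \<and> (\<forall>a b. h (a * b) = h a * h b) \<and>
       (\<forall>r a. h (scaleR r a) = scaleR r (h a)) \<and> (\<forall>a. norm (h a) = norm a) \<and>
       (range h = \<real> \<or> range h = UNIV)"
    by (rule exI[of _ complex_of_real]) (simp add: Reals_def scaleR_conv_of_real)
qed

instance complex :: real_or_complex
proof
  show "\<exists>h :: complex \<Rightarrow> complex.
       (\<forall>a b. h (a + b) = h a + h b) \<and> (\<forall>a b. h (a * b) = h a * h b) \<and>
       (\<forall>r a. h (scaleR r a) = scaleR r (h a)) \<and> (\<forall>a. norm (h a) = norm a) \<and>
       (range h = \<real> \<or> range h = UNIV)"
    by (rule exI[of _ "\<lambda>a. a"]) simp
qed

text \<open>The vector space is a whole type; its scalar multiplication \<open>scale\<close> and its quasi-norm \<open>q\<close>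
  are explicit parameters, because the type classes of normed spaces do not cover quasi-norms.\<close>

locale quasi_banach = vector_space scale
  for scale :: "'k::real_or_complex \<Rightarrow> 'v::ab_group_add \<Rightarrow> 'v" +
  fixes q :: "'v \<Rightarrow> real"
  assumes q_nonneg: "0 \<le> q f"
    and q_eq_0_iff: "q f = 0 \<longleftrightarrow> f = 0"
    and q_scale: "q (scale c f) = norm c * q f"
    and q_quasi_triangle: "\<exists>\<kappa>\<ge>1. \<forall>f g. q (f + g) \<le> \<kappa> * (q f + q g)"
    and q_complete: "(\<forall>e>0. \<exists>N. \<forall>m\<ge>N. \<forall>n\<ge>N. q (u m - u n) < e) \<Longrightarrow>
                     \<exists>l. (\<lambda>n. q (u n - l)) \<longlonglongrightarrow> 0"

text \<open>All suprema are taken in \<^typ>\<open>ennreal\<close>, so that no boundedness proviso is needed.\<close>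

definition dual_norm :: "('v \<Rightarrow> real) \<Rightarrow> ('v \<Rightarrow> 'k::real_or_complex) \<Rightarrow> ennreal" where
  "dual_norm q F = (SUP f\<in>{f. q f \<le> 1}. ennreal (norm (F f)))"

text \<open>The last conjunct of the following definition includes that every \<open>xs n\<close> is continuous,
  i.e. has finite dual norm.\<close>

definition is_dual_sequence ::
  "('k::real_or_complex \<Rightarrow> 'v::ab_group_add \<Rightarrow> 'v) \<Rightarrow> ('v \<Rightarrow> real) \<Rightarrow> (nat \<Rightarrow> 'v) \<Rightarrow>
   (nat \<Rightarrow> 'v \<Rightarrow> 'k) \<Rightarrow> bool" where
  "is_dual_sequence scale q x xs \<longleftrightarrow>
     (\<forall>n. Vector_Spaces.linear scale (*) (xs n)) \<and>
     (\<forall>n k. xs n (x k) = (if n = k then 1 else 0)) \<and>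
     (\<exists>C::real. \<forall>n. dual_norm q (xs n) \<le> ennreal C)"

text \<open>Sequences are indexed from \<open>0\<close>. A space with a basis in the following sense is automatically
  separable (the span of a sequence is dense) and infinite-dimensional (the sequence has
  biorthogonal functionals), so these two properties are not required separately.\<close>

definition is_basis ::
  "('k::real_or_complex \<Rightarrow> 'v::ab_group_add \<Rightarrow> 'v) \<Rightarrow> ('v \<Rightarrow> real) \<Rightarrow> (nat \<Rightarrow> 'v) \<Rightarrow> bool" where
  "is_basis scale q x \<longleftrightarrow>
     quasi_banach scale q \<and>
     (\<exists>C. \<forall>n. q (x n) \<le> C) \<and>
     (\<forall>f. \<forall>e>0. \<exists>g\<in>module.span scale (range x). q (f - g) < e) \<and>
     (\<exists>xs. is_dual_sequence scale q x xs)"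

text \<open>Well defined for a basis: the functionals are continuous and determined on a dense
  subspace.\<close>

definition dual_basis ::
  "('k::real_or_complex \<Rightarrow> 'v::ab_group_add \<Rightarrow> 'v) \<Rightarrow> ('v \<Rightarrow> real) \<Rightarrow> (nat \<Rightarrow> 'v) \<Rightarrow>
   nat \<Rightarrow> 'v \<Rightarrow> 'k" where
  "dual_basis scale q x = (THE xs. is_dual_sequence scale q x xs)"

definition phi_u ::
  "('k::real_or_complex \<Rightarrow> 'v::ab_group_add \<Rightarrow> 'v) \<Rightarrow> ('v \<Rightarrow> real) \<Rightarrow> (nat \<Rightarrow> 'v) \<Rightarrow>
   nat \<Rightarrow> ennreal" where
  "phi_u scale q x m =
     (SUP (A, \<epsilon>)\<in>{(A, \<epsilon>). finite A \<and> card A \<le> m \<and> (\<forall>n\<in>A. norm (\<epsilon> n) = 1)}.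
        ennreal (q (\<Sum>n\<in>A. scale (\<epsilon> n) (x n))))"

definition phi :: "('v::ab_group_add \<Rightarrow> real) \<Rightarrow> (nat \<Rightarrow> 'v) \<Rightarrow> nat \<Rightarrow> ennreal" where
  "phi q x m = (SUP A\<in>{A. finite A \<and> card A \<le> m}. ennreal (q (\<Sum>k\<in>A. x k)))"

definition phi_dual ::
  "('k::real_or_complex \<Rightarrow> 'v::ab_group_add \<Rightarrow> 'v) \<Rightarrow> ('v \<Rightarrow> real) \<Rightarrow> (nat \<Rightarrow> 'v) \<Rightarrow>
   nat \<Rightarrow> ennreal" where
  "phi_dual scale q x m =
     (SUP A\<in>{A. finite A \<and> card A \<le> m}. dual_norm q (\<lambda>f. \<Sum>k\<in>A. dual_basis scale q x k f))"

definition bidemocratic_basis ::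
  "('k::real_or_complex \<Rightarrow> 'v::ab_group_add \<Rightarrow> 'v) \<Rightarrow> ('v \<Rightarrow> real) \<Rightarrow> (nat \<Rightarrow> 'v) \<Rightarrow> bool" where
  "bidemocratic_basis scale q x \<longleftrightarrow>
     is_basis scale q x \<and>
     (\<exists>\<Delta>::real. \<forall>m. phi q x m * phi_dual scale q x m \<le> ennreal \<Delta> * of_nat m)"

definition greedy_set ::
  "('k::real_or_complex \<Rightarrow> 'v::ab_group_add \<Rightarrow> 'v) \<Rightarrow> ('v \<Rightarrow> real) \<Rightarrow> (nat \<Rightarrow> 'v) \<Rightarrow>
   'v \<Rightarrow> nat set \<Rightarrow> bool" where
  "greedy_set scale q x f A \<longleftrightarrow>
     finite A \<and>
     (\<forall>n\<in>A. \<forall>k. k \<notin> A \<longrightarrow> norm (dual_basis scale q x n f) \<ge> norm (dual_basis scale q x k f))"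

definition coord_proj ::
  "('k::real_or_complex \<Rightarrow> 'v::ab_group_add \<Rightarrow> 'v) \<Rightarrow> ('v \<Rightarrow> real) \<Rightarrow> (nat \<Rightarrow> 'v) \<Rightarrow>
   nat set \<Rightarrow> 'v \<Rightarrow> 'v" where
  "coord_proj scale q x A f = (\<Sum>n\<in>A. scale (dual_basis scale q x n f) (x n))"

definition g_bar ::
  "('k::real_or_complex \<Rightarrow> 'v::ab_group_add \<Rightarrow> 'v) \<Rightarrow> ('v \<Rightarrow> real) \<Rightarrow> (nat \<Rightarrow> 'v) \<Rightarrow>
   nat \<Rightarrow> ennreal" where
  "g_bar scale q x m =
     (SUP (A, f)\<in>{(A, f). greedy_set scale q x f A \<and> q f \<le> 1 \<and> card A = m}.
        ennreal (q (coord_proj scale q x A f)))"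

definition g_param ::
  "('k::real_or_complex \<Rightarrow> 'v::ab_group_add \<Rightarrow> 'v) \<Rightarrow> ('v \<Rightarrow> real) \<Rightarrow> (nat \<Rightarrow> 'v) \<Rightarrow>
   nat \<Rightarrow> ennreal" where
  "g_param scale q x m = (SUP k\<in>{..m}. g_bar scale q x k)"

definition quasi_greedy_basis ::
  "('k::real_or_complex \<Rightarrow> 'v::ab_group_add \<Rightarrow> 'v) \<Rightarrow> ('v \<Rightarrow> real) \<Rightarrow> (nat \<Rightarrow> 'v) \<Rightarrow> bool" where
  "quasi_greedy_basis scale q x \<longleftrightarrow>
     is_basis scale q x \<and> (SUP m. g_param scale q x m) < \<infinity>"

definition sum_scale ::
  "('k \<Rightarrow> 'v \<Rightarrow> 'v) \<Rightarrow> ('k \<Rightarrow> 'w \<Rightarrow> 'w) \<Rightarrow> 'k \<Rightarrow> 'v \<times> 'w \<Rightarrow> 'v \<times> 'w" where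
  "sum_scale scaleX scaleY c = (\<lambda>(f, g). (scaleX c f, scaleY c g))"

definition sum_qnorm :: "('v \<Rightarrow> real) \<Rightarrow> ('w \<Rightarrow> real) \<Rightarrow> 'v \<times> 'w \<Rightarrow> real" where
  "sum_qnorm qX qY = (\<lambda>(f, g). max (qX f) (qY g))"

text \<open>With indices from \<open>0\<close>, the odd-numbered terms of the one-based sequence are
  \<open>z 0, z 2, z 4, \<dots>\<close>.\<close>

definition diamond ::
  "('k::real_or_complex \<Rightarrow> 'v \<Rightarrow> 'v) \<Rightarrow> ('k \<Rightarrow> 'w::ab_group_add \<Rightarrow> 'w) \<Rightarrow>
   (nat \<Rightarrow> 'v) \<Rightarrow> (nat \<Rightarrow> 'w) \<Rightarrow> nat \<Rightarrow> 'v \<times> 'w" where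
  "diamond scaleX scaleY x y n =
     sum_scale scaleX scaleY (of_real (1 / sqrt 2))
       (x (n div 2), if even n then y (n div 2) else - y (n div 2))"

definition approx_equiv :: "(nat \<Rightarrow> ennreal) \<Rightarrow> (nat \<Rightarrow> ennreal) \<Rightarrow> bool" where
  "approx_equiv \<alpha> \<beta> \<longleftrightarrow>
     (\<exists>c C::real. 0 < c \<and> c \<le> C \<and>
        (\<forall>m. ennreal c * \<beta> m \<le> \<alpha> m \<and> \<alpha> m \<le> ennreal C * \<beta> m))"

end

theory Submission
  imports Defs
begin

text \<open>In a bidemocratic basis, if \<open>\<bar>x\<^sub>n\<^sup>*(f)\<bar> \<ge> t\<close> on a set of size \<open>m\<close> and
  \<open>\<parallel>f\<parallel> \<le> 1\<close>, then \<open>t \<phi>\<^sub>u(m)\<close> is bounded by a constant, because \<open>m t\<close> is at most a multiple of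
  \<open>\<phi>\<^sup>*(m)\<close>. Hence all vectors supported on \<open>m\<close> indices with coefficients at most \<open>t\<close> are bounded,
  and under the hypothesis on \<open>\<phi>\<^sub>u\<close> this holds also across the two spaces.

  Upper bound: let \<open>D\<close> be a greedy set of \<open>(f, g)\<close>, let \<open>a\<close>, \<open>b\<close> be the coefficients of \<open>f\<close>, \<open>g\<close>, and let
  \<open>s\<close> be the least value of \<open>\<bar>a\<^sub>n \<plusminus> b\<^sub>n\<bar>\<close> on \<open>D\<close>. The first component of the projection onto \<open>D\<close>
  differs from \<open>S\<^sub>A(f)\<close>, where \<open>A = {n. \<bar>a\<^sub>n\<bar> > s}\<close> is greedy for \<open>f\<close>, by coefficients of size at most
  \<open>3s/2\<close> on the set of indices met by \<open>D\<close>, and at each of these \<open>\<bar>a\<^sub>n\<bar> \<ge> s/2\<close> or \<open>\<bar>b\<^sub>n\<bar> \<ge> s/2\<close>.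

  Lower bound: doubling a greedy set of \<open>f\<close> gives a greedy set of \<open>(f, 0)\<close> of twice the size; this is
  harmless because only the larger half of a greedy set matters up to a bounded error.\<close>

section \<open>Scalars and finite sums\<close>

text \<open>Over the complex scalars \<open>i\<close> is the preimage of the imaginary unit under
  \<open>h\<close>; over the reals \<open>i = 1\<close> with \<open>s = 0\<close> serves. So one
  decomposition reduces coefficients from either field to real ones.\<close>

lemma real_or_complex_decomposition:
  obtains i :: "'k::real_or_complex" where "norm i = 1"
    and "\<And>d. \<exists>r s. d = of_real r + of_real s * i \<and> \<bar>r\<bar> \<le> norm d \<and> \<bar>s\<bar> \<le> norm d"
proof -
  obtain h :: "'k \<Rightarrow> complex" where add: "\<And>a b. h (a + b) = h a + h b"
    and mult: "\<And>a b. h (a * b) = h a * h b"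
    and scaleR: "\<And>r a. h (scaleR r a) = scaleR r (h a)"
    and norm: "\<And>a. norm (h a) = norm a"
    and range: "range h = \<real> \<or> range h = UNIV"
    using real_or_complex by blast
  have inj: "a = b" if "h a = h b" for a b
  proof -
    have "h (a - b) + h b = h a" by (simp flip: add)
    then have "h (a - b) = 0" using that by simp
    then show ?thesis using norm[of "a - b"] by simp
  qed
  \<comment> \<open>By multiplicativity \<open>h 1\<close> is idempotent; being nonzero, it equals
    1.\<close>
  have "h 1 \<noteq> 0" using norm[of 1] by auto
  then have h1: "h 1 = 1" using mult[of 1 1] by simp
  have of_real: "h (of_real r) = of_real r" for r
    using scaleR[of r 1] h1 by (simp add: of_real_def)
  show thesis
  proof (cases "range h = UNIV")
    case True
    then obtain i where i: "h i = \<i>" by (metis surjD)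
    show thesis
    proof (rule that)
      show "norm i = 1" using norm[of i] i by simp
      show "\<exists>r s. d = of_real r + of_real s * i \<and> \<bar>r\<bar> \<le> norm d \<and> \<bar>s\<bar> \<le> norm d" for d
      proof (intro exI conjI)
        show "d = of_real (Re (h d)) + of_real (Im (h d)) * i"
          by (rule inj) (simp add: add mult of_real i complex_eq_iff)
        show "\<bar>Re (h d)\<bar> \<le> norm d" "\<bar>Im (h d)\<bar> \<le> norm d"
          using abs_Re_le_cmod[of "h d"] abs_Im_le_cmod[of "h d"] by (simp_all add: norm)
      qed
    qed
  next
    case False
    with range have "range h = \<real>" by blast
    then have real: "h d = of_real (Re (h d))" for d
      by (metis Reals_cases Re_complex_of_real rangeI)
    show thesis
    proof (rule that)
      show "norm (1::'k) = 1" by simp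
      show "\<exists>r s. d = of_real r + of_real s * 1 \<and> \<bar>r\<bar> \<le> norm d \<and> \<bar>s\<bar> \<le> norm d" for d :: 'k
      proof (intro exI conjI)
        show "d = of_real (Re (h d)) + of_real 0 * 1"
          by (rule inj) (simp add: of_real flip: real)
        show "\<bar>Re (h d)\<bar> \<le> norm d"
          using abs_Re_le_cmod[of "h d"] by (simp add: norm)
      qed simp
    qed
  qed
qed

text \<open>The nonnegative terms and the negative terms each form a subset sum of absolute value at
  most \<open>M\<close>.\<close>

lemma sum_abs_le_subset_sums:
  fixes r :: "'i \<Rightarrow> real"
  assumes "finite B" and "\<And>B'. B' \<subseteq> B \<Longrightarrow> \<bar>sum r B'\<bar> \<le> M"
  shows "(\<Sum>n\<in>B. \<bar>r n\<bar>) \<le> 2 * M"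
proof -
  have "(\<Sum>n\<in>B. \<bar>r n\<bar>) = (\<Sum>n\<in>B. if 0 \<le> r n then r n else 0) - (\<Sum>n\<in>B. if \<not> 0 \<le> r n then r n else 0)"
    unfolding sum_subtractf[symmetric] by (rule sum.cong) auto
  also have "\<dots> = sum r (B \<inter> {n. 0 \<le> r n}) - sum r (B \<inter> {n. \<not> 0 \<le> r n})"
    using assms(1) by (simp add: sum.If_cases)
  also have "\<dots> \<le> 2 * M"
    using assms(2)[of "B \<inter> {n. 0 \<le> r n}"] assms(2)[of "B \<inter> {n. \<not> 0 \<le> r n}"] by auto
  finally show ?thesis .
qed

text \<open>Real and imaginary parts each contribute \<open>2 * M\<close>. In this way the dual
  fundamental function, whose sums carry no signs, controls sums of absolute values of
  coefficients.\<close>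

lemma sum_norm_le_subset_sums:
  fixes a :: "'i \<Rightarrow> 'k::real_or_complex"
  assumes "finite B" and "\<And>B'. B' \<subseteq> B \<Longrightarrow> norm (sum a B') \<le> M"
  shows "(\<Sum>n\<in>B. norm (a n)) \<le> 4 * M"
proof -
  obtain h :: "'k \<Rightarrow> complex" where add: "\<And>a b. h (a + b) = h a + h b"
    and norm: "\<And>a. norm (h a) = norm a"
    using real_or_complex by blast
  have "h 0 = 0" using add[of 0 0] by simp
  then have h_sum: "h (sum a B') = (\<Sum>n\<in>B'. h (a n))" for B'
    by (induction B' rule: infinite_finite_induct) (simp_all add: add)
  have M: "norm (\<Sum>n\<in>B'. h (a n)) \<le> M" if "B' \<subseteq> B" for B'
    using assms(2)[OF that] norm by (simp flip: h_sum)
  have Re: "(\<Sum>n\<in>B. \<bar>Re (h (a n))\<bar>) \<le> 2 * M"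
    using assms(1)
  proof (rule sum_abs_le_subset_sums)
    fix B' assume "B' \<subseteq> B"
    from order_trans[OF abs_Re_le_cmod M[OF this]] show "\<bar>\<Sum>n\<in>B'. Re (h (a n))\<bar> \<le> M"
      by simp
  qed
  have Im: "(\<Sum>n\<in>B. \<bar>Im (h (a n))\<bar>) \<le> 2 * M"
    using assms(1)
  proof (rule sum_abs_le_subset_sums)
    fix B' assume "B' \<subseteq> B"
    from order_trans[OF abs_Im_le_cmod M[OF this]] show "\<bar>\<Sum>n\<in>B'. Im (h (a n))\<bar> \<le> M"
      by simp
  qed
  have "(\<Sum>n\<in>B. norm (a n)) \<le> (\<Sum>n\<in>B. \<bar>Re (h (a n))\<bar> + \<bar>Im (h (a n))\<bar>)"
    by (rule sum_mono) (metis norm cmod_le)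
  also have "\<dots> \<le> 4 * M" using Re Im by (simp add: sum.distrib)
  finally show ?thesis .
qed

lemma finite_obtain_max:
  fixes v :: "'i \<Rightarrow> 'a::linorder"
  assumes "finite A" and "A \<noteq> {}"
  obtains j where "j \<in> A" and "\<And>k. k \<in> A \<Longrightarrow> v k \<le> v j"
proof -
  have fin: "finite (v ` A)" and "v ` A \<noteq> {}" using assms by simp_all
  then have "Max (v ` A) \<in> v ` A" by (rule Max_in)
  then obtain j where "j \<in> A" "Max (v ` A) = v j" by blast
  with Max_ge[OF fin] show thesis by (intro that[of j]) auto
qed

text \<open>The subset grows by one largest remaining element at a time.\<close>

lemma exists_top_subset:
  fixes v :: "'i \<Rightarrow> 'a::linorder"
  assumes "finite A" and "l \<le> card A"
  shows "\<exists>A1\<subseteq>A. card A1 = l \<and> (\<forall>n\<in>A1. \<forall>k\<in>A - A1. v k \<le> v n)"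
  using assms(2)
proof (induction l)
  case 0
  show ?case by (rule exI[of _ "{}"]) simp
next
  case (Suc l)
  then obtain A1 where A1: "A1 \<subseteq> A" "card A1 = l" "\<forall>n\<in>A1. \<forall>k\<in>A - A1. v k \<le> v n" by auto
  have "A \<noteq> A1" using Suc.prems A1(2) by auto
  then have "A - A1 \<noteq> {}" using A1(1) by blast
  with assms(1) obtain j where j: "j \<in> A - A1" "\<And>k. k \<in> A - A1 \<Longrightarrow> v k \<le> v j"
    using finite_obtain_max[of "A - A1" v] by blast
  show ?case
  proof (intro exI[of _ "insert j A1"] conjI ballI)
    show "card (insert j A1) = Suc l"
      using A1 j(1) finite_subset[OF A1(1) assms(1)] by simp
    show "v k \<le> v n" if "n \<in> insert j A1" "k \<in> A - insert j A1" for n k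
      using that A1 j by auto
  qed (use A1 j in auto)
qed

section \<open>Sums in quasi-Banach spaces\<close>

context quasi_banach
begin

lemma q_0 [simp]: "q 0 = 0"
  by (simp add: q_eq_0_iff)

lemma q_minus [simp]: "q (- f) = q f"
  using q_scale[of "-1" f] by simp

definition kappa :: real where
  "kappa = (SOME \<kappa>. 1 \<le> \<kappa> \<and> (\<forall>f g. q (f + g) \<le> \<kappa> * (q f + q g)))"

lemma kappa_ge_1: "1 \<le> kappa" and q_add_le: "q (f + g) \<le> kappa * (q f + q g)"
proof -
  have "1 \<le> kappa \<and> (\<forall>f g. q (f + g) \<le> kappa * (q f + q g))"
    unfolding kappa_def by (rule someI_ex) (use q_quasi_triangle in blast)
  then show "1 \<le> kappa" "q (f + g) \<le> kappa * (q f + q g)" by auto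
qed

lemma q_add_le_bounds:
  assumes "q f \<le> a" and "q g \<le> b"
  shows "q (f + g) \<le> kappa * (a + b)"
proof -
  have "q (f + g) \<le> kappa * (q f + q g)" by (rule q_add_le)
  also have "\<dots> \<le> kappa * (a + b)" using assms kappa_ge_1 by (intro mult_left_mono) auto
  finally show ?thesis .
qed

text \<open>Iterating the quasi-triangle inequality gives a constant exponential in the number of
  terms. This is harmless below, where it is applied to a fixed number of terms or only to see that
  a supremum is finite.\<close>

lemma q_sum_le:
  assumes "finite I" and "\<And>i. i \<in> I \<Longrightarrow> q (v i) \<le> P" and "0 \<le> P"
  shows "q (sum v I) \<le> kappa ^ card I * (real (card I) * P)"
  using assms(1,2)
proof (induction I)
  case (insert i I)
  let ?c = "card I"
  have "P \<le> kappa ^ ?c * P"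
    using mult_right_mono[OF one_le_power[OF kappa_ge_1] assms(3)] by simp
  moreover have "q (sum v I) \<le> kappa ^ ?c * (real ?c * P)" using insert by simp
  moreover have "q (v i) \<le> P" using insert by simp
  ultimately have "q (v i + sum v I) \<le> kappa * (kappa ^ ?c * P + kappa ^ ?c * (real ?c * P))"
    by (intro q_add_le_bounds) auto
  then show ?case using insert by (simp add: algebra_simps)
qed simp

text \<open>Rounding the coefficients down to multiples of \<open>1/N\<close> leaves an error of the same kind, smaller
  by the factor \<open>N\<close>; for \<open>N \<ge> 2\<kappa>\<close> the supremum of all such quasi-norms can be absorbed.
  This replaces the \<open>p\<close>-convexity provided by the Aoki--Rolewicz theorem.\<close>

lemma q_unit_interval_coeffs_le:
  obtains K where "0 \<le> K"
    and "\<And>(R::'i set) v P p. finite R \<Longrightarrow> (\<And>A. A \<subseteq> R \<Longrightarrow> q (sum v A) \<le> P) \<Longrightarrow>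
           (\<And>n. n \<in> R \<Longrightarrow> 0 \<le> p n \<and> p n \<le> 1) \<Longrightarrow> q (\<Sum>n\<in>R. scale (of_real (p n)) (v n)) \<le> K * P"
proof -
  define N where "N = nat \<lceil>2 * kappa\<rceil>"
  have N: "2 * kappa \<le> real N" "0 < N" using kappa_ge_1 unfolding N_def by linarith+
  \<comment> \<open>The power \<open>kappa ^ N\<close> stems from summing \<open>N\<close> layers,
    one more \<open>kappa\<close> from splitting off the rounding error, and 2 from absorbing the
    supremum.\<close>
  define K where "K = 2 * (kappa * kappa ^ N)"
  have bound: "q (\<Sum>n\<in>R. scale (of_real (p n)) (v n)) \<le> K * P"
    if R: "finite R" and P: "\<And>A. A \<subseteq> R \<Longrightarrow> q (sum v A) \<le> P"
      and p: "\<And>n. n \<in> R \<Longrightarrow> 0 \<le> p n \<and> p n \<le> 1"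
    for R :: "'i set" and v P and p :: "'i \<Rightarrow> real"
  proof -
    have P0: "0 \<le> P" using P[of "{}"] by simp
    define E where "E = {p :: 'i \<Rightarrow> real. \<forall>n\<in>R. 0 \<le> p n \<and> p n \<le> 1}"
    define F where "F p = q (\<Sum>n\<in>R. scale (of_real (p n)) (v n))" for p :: "'i \<Rightarrow> real"
    define W where "W = (SUP p\<in>E. F p)"
    have pE: "p \<in> E" using p by (simp add: E_def)
    \<comment> \<open>This bound depends on the size of \<open>R\<close>, but it serves only to make
      the supremum \<open>W\<close> finite, so that \<open>W\<close> can be moved across an
      inequality.\<close>
    have "F p \<le> kappa ^ card R * (real (card R) * P)" if "p \<in> E" for p
      unfolding F_def
    proof (rule q_sum_le[OF R _ P0])
      fix n assume n: "n \<in> R"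
      then have "\<bar>p n\<bar> \<le> 1" using that by (simp add: E_def)
      then have "\<bar>p n\<bar> * q (v n) \<le> 1 * q (v n)" by (rule mult_right_mono) (rule q_nonneg)
      also have "\<dots> \<le> P" using P[of "{n}"] n by simp
      finally show "q (scale (of_real (p n)) (v n)) \<le> P" by (simp add: q_scale)
    qed
    then have bdd: "bdd_above (F ` E)" by (rule bdd_aboveI2)
    have step: "F p \<le> kappa * (kappa ^ N * P + W / N)" if p: "p \<in> E" for p
    proof -
      define l where "l n = nat \<lfloor>p n * N\<rfloor>" for n
      define e where "e n = p n * N - l n" for n
      have l: "real (l n) \<le> p n * N" "p n * N < real (l n) + 1" "l n \<le> N" if "n \<in> R" for n
      proof -
        have "0 \<le> p n" "p n \<le> 1" using p that by (auto simp: E_def)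
        then have "0 \<le> p n * N" "p n * N \<le> 1 * N"
          by (simp_all add: mult_left_le_one_le mult_right_mono)
        then show "real (l n) \<le> p n * N" "p n * N < real (l n) + 1" "l n \<le> N"
          unfolding l_def by linarith+
      qed
      have eE: "e \<in> E" using l unfolding E_def e_def by fastforce
      have split: "of_real (p n) = of_real (1 / N) * (of_nat (l n) + (of_real (e n) :: 'k))" for n
      proof -
        have "p n = 1 / N * (real (l n) + e n)" using N by (simp add: e_def)
        then show ?thesis by (metis of_real_add of_real_mult of_real_of_nat_eq)
      qed
      \<comment> \<open>Layers: \<open>l n\<close> is the number of \<open>i < N\<close> with
        \<open>i < l n\<close>. Exchanging the sums leaves \<open>N\<close> subset sums of
        \<open>v\<close>, each bounded by \<open>P\<close>.\<close>
      have "(\<Sum>n\<in>R. scale (of_nat (l n)) (v n)) = (\<Sum>n\<in>R. \<Sum>i<N. if i < l n then v n else 0)"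
      proof (rule sum.cong[OF refl])
        fix n assume "n \<in> R"
        then have "{..<N} \<inter> {i. i < l n} = {..<l n}" using l(3) by force
        then show "scale (of_nat (l n)) (v n) = (\<Sum>i<N. if i < l n then v n else 0)"
          by (simp add: sum.If_cases sum_constant_scale)
      qed
      also have "\<dots> = (\<Sum>i<N. sum v (R \<inter> {n. i < l n}))"
        by (subst sum.swap) (simp add: sum.If_cases R)
      finally have "q (\<Sum>n\<in>R. scale (of_nat (l n)) (v n)) \<le> kappa ^ N * (N * P)"
        using q_sum_le[of "{..<N}" "\<lambda>i. sum v (R \<inter> {n. i < l n})" P] P P0 by simp
      then have 1: "q (scale (of_real (1 / N)) (\<Sum>n\<in>R. scale (of_nat (l n)) (v n))) \<le> kappa ^ N * P"
        using N by (simp add: q_scale norm_divide field_simps)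
      have "F e \<le> W" unfolding W_def using bdd eE by (rule cSUP_upper2) simp
      then have 2: "q (scale (of_real (1 / N)) (\<Sum>n\<in>R. scale (of_real (e n)) (v n))) \<le> W / N"
        using N by (simp add: q_scale F_def norm_divide field_simps)
      have "F p = q (scale (of_real (1 / N)) (\<Sum>n\<in>R. scale (of_nat (l n)) (v n)) +
                     scale (of_real (1 / N)) (\<Sum>n\<in>R. scale (of_real (e n)) (v n)))"
        unfolding F_def split by (simp only: scale_scale[symmetric] scale_left_distrib sum.distrib
            scale_right_distrib scale_sum_right)
      also have "\<dots> \<le> kappa * (kappa ^ N * P + W / N)" by (rule q_add_le_bounds[OF 1 2])
      finally show ?thesis .
    qed
    \<comment> \<open>\<open>W\<close> is nonnegative and \<open>kappa / N\<close> is at most 1/2 by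
      the choice of \<open>N\<close>, so the error term is at most half of \<open>W\<close>.\<close>
    have "0 \<le> F p" by (simp add: F_def q_nonneg)
    also have "F p \<le> W" unfolding W_def using bdd pE by (rule cSUP_upper2) simp
    finally have "kappa / N * W \<le> 1 / 2 * W" 
      using N by (intro mult_right_mono) (simp_all add: field_simps)
    moreover have "W \<le> kappa * (kappa ^ N * P + W / N)"
      unfolding W_def by (rule cSUP_least) (use pE step[unfolded W_def] in auto)
    then have "W \<le> kappa * (kappa ^ N * P) + kappa / N * W" by (simp add: distrib_left)
    ultimately have "W \<le> 2 * (kappa * (kappa ^ N * P))" by linarith
    then have "W \<le> K * P" by (simp add: K_def mult.assoc)
    with \<open>F p \<le> W\<close> show ?thesis by (simp add: F_def)
  qed
  have "0 \<le> K" using kappa_ge_1 by (simp add: K_def)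
  then show thesis using bound by (rule that)
qed

text \<open>Splitting the coefficients into real and imaginary parts, and these into positive and
  negative parts, leaves four sums whose coefficients lie in the unit interval after division by
  \<open>t\<close>. Each of the two splittings costs a factor \<open>kappa\<close>.\<close>

lemma q_bounded_coeffs_le:
  obtains K where "0 \<le> K"
    and "\<And>(R::'i set) v P d t. finite R \<Longrightarrow> (\<And>A. A \<subseteq> R \<Longrightarrow> q (sum v A) \<le> P) \<Longrightarrow>
           (\<And>n. n \<in> R \<Longrightarrow> norm (d n) \<le> t) \<Longrightarrow> 0 \<le> t \<Longrightarrow> q (\<Sum>n\<in>R. scale (d n) (v n)) \<le> K * (t * P)"
proof -
  obtain K where K0: "K \<ge> 0" and K: "\<And>(R::'i set) v P p. finite R \<Longrightarrow> (\<And>A. A \<subseteq> R \<Longrightarrow> q (sum v A) \<le> P) \<Longrightarrow>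
     (\<And>n. n \<in> R \<Longrightarrow> 0 \<le> p n \<and> p n \<le> 1) \<Longrightarrow> q (\<Sum>n\<in>R. scale (of_real (p n)) (v n)) \<le> K * P"
    by (rule q_unit_interval_coeffs_le) blast
  obtain i :: 'k where i: "norm i = 1"
    and ex: "\<And>d. \<exists>r s. d = of_real r + of_real s * i \<and> \<bar>r\<bar> \<le> norm d \<and> \<bar>s\<bar> \<le> norm d"
    using real_or_complex_decomposition by blast
  obtain re im where dec: "\<And>d. d = of_real (re d) + of_real (im d) * i"
    and re: "\<And>d. \<bar>re d\<bar> \<le> norm d" and im: "\<And>d. \<bar>im d\<bar> \<le> norm d"
    using ex by metis
  have bound: "q (\<Sum>n\<in>R. scale (d n) (v n)) \<le> (4 * kappa * kappa * K) * (t * P)"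
    if R: "finite R" and P: "\<And>A. A \<subseteq> R \<Longrightarrow> q (sum v A) \<le> P"
      and d: "\<And>n. n \<in> R \<Longrightarrow> norm (d n) \<le> t" and "0 \<le> t"
    for R :: "'i set" and v P d t
  proof (cases "t = 0")
    case True
    have "(\<Sum>n\<in>R. scale (d n) (v n)) = 0" using d True by (intro sum.neutral) simp
    then show ?thesis using True by simp
  next
    case False
    with \<open>0 \<le> t\<close> have t: "0 < t" by simp
    have real: "q (\<Sum>n\<in>R. scale (of_real (r n)) (v n)) \<le> kappa * (K * (t * P) + K * (t * P))"
      if r: "\<And>n. n \<in> R \<Longrightarrow> \<bar>r n\<bar> \<le> t" for r
    proof -
      have nonneg: "q (\<Sum>n\<in>R. scale (of_real (p n)) (v n)) \<le> K * (t * P)"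
        if "\<And>n. n \<in> R \<Longrightarrow> 0 \<le> p n \<and> p n \<le> t" for p
      proof -
        have "q (\<Sum>n\<in>R. scale (of_real (p n / t)) (v n)) \<le> K * P"
          using R P by (rule K) (use that t in auto)
        moreover have "(\<Sum>n\<in>R. scale (of_real (p n)) (v n)) =
            scale (of_real t) (\<Sum>n\<in>R. scale (of_real (p n / t)) (v n))"
          using t by (simp add: scale_sum_right)
        ultimately show ?thesis using t by (simp add: q_scale mult.left_commute)
      qed
      have "r n = max (r n) 0 - max (- r n) 0" for n by simp
      then have r_eq: "(of_real (r n) :: 'k) = of_real (max (r n) 0) - of_real (max (- r n) 0)" for n
        by (metis of_real_diff)
      have "(\<Sum>n\<in>R. scale (of_real (r n)) (v n)) =
          (\<Sum>n\<in>R. scale (of_real (max (r n) 0)) (v n)) + - (\<Sum>n\<in>R. scale (of_real (max (- r n) 0)) (v n))"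
        by (subst r_eq) (simp add: scale_left_diff_distrib sum_subtractf)
      also have "q \<dots> \<le> kappa * (K * (t * P) + K * (t * P))"
        unfolding q_minus using r by (intro q_add_le_bounds; (subst q_minus)?; intro nonneg) fastforce+
      finally show ?thesis .
    qed
    have "(\<Sum>n\<in>R. scale (d n) (v n)) = (\<Sum>n\<in>R. scale (of_real (re (d n))) (v n)) +
        scale i (\<Sum>n\<in>R. scale (of_real (im (d n))) (v n))"
      by (subst dec) (simp add: scale_left_distrib sum.distrib scale_sum_right mult.commute)
    also have "q \<dots> \<le> kappa * (kappa * (K * (t * P) + K * (t * P)) + kappa * (K * (t * P) + K * (t * P)))"
      by (intro q_add_le_bounds; (subst q_scale, simp only: i mult_1)?; intro real)
        (use re im d order_trans in blast)+
    finally show ?thesis by (simp add: algebra_simps)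
  qed
  have "0 \<le> 4 * kappa * kappa * K" using K0 kappa_ge_1 by simp
  then show thesis using bound by (rule that)
qed

end

section \<open>Bidemocratic bases and greedy sets\<close>

lemma ennreal_norm_le_dual_norm: "q f \<le> 1 \<Longrightarrow> ennreal (norm (F f)) \<le> dual_norm q F"
  unfolding dual_norm_def by (rule SUP_upper) simp

context quasi_banach
begin

lemma dual_sequence_bounded:
  assumes "is_dual_sequence scale q x xs"
  shows "\<exists>C\<ge>0. \<forall>n f. norm (xs n f) \<le> C * q f"
proof -
  obtain C where C: "\<And>n. dual_norm q (xs n) \<le> ennreal C"
    using assms unfolding is_dual_sequence_def by blast
  \<comment> \<open>The real \<open>C\<close> may be negative, in which case
    \<open>ennreal C\<close> is 0.\<close>
  have "norm (xs n f) \<le> max C 0 * q f" for n f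
  proof (cases "f = 0")
    case True
    interpret Vector_Spaces.linear scale "(*)" "xs n" using assms by (simp add: is_dual_sequence_def)
    show ?thesis using True by simp
  next
    case False
    interpret xs: Vector_Spaces.linear scale "(*)" "xs n" using assms by (simp add: is_dual_sequence_def)
    have q: "0 < q f" using False q_eq_0_iff q_nonneg[of f] by (simp add: less_le)
    let ?g = "scale (of_real (1 / q f)) f"
    have "q ?g \<le> 1" using q by (simp add: q_scale norm_divide)
    then have "ennreal (norm (xs n ?g)) \<le> ennreal C"
      by (rule order_trans[OF ennreal_norm_le_dual_norm C])
    also have "\<dots> \<le> ennreal (max C 0)" by (rule ennreal_leI) simp
    finally have "norm (xs n ?g) \<le> max C 0" by (subst (asm) ennreal_le_iff) auto
    then show ?thesis using q by (simp add: xs.scale norm_mult norm_divide field_simps)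
  qed
  then show ?thesis by (intro exI[of _ "max C 0"]) simp
qed

text \<open>Two bounded functionals that agree on the basis vectors agree on the dense span, hence
  everywhere. This gives the \<open>THE\<close> in \<open>dual_basis\<close> its meaning.\<close>

lemma dual_sequence_unique:
  assumes "is_basis scale q x" and "is_dual_sequence scale q x xs" and "is_dual_sequence scale q x ys"
  shows "xs = ys"
proof (intro ext)
  fix n f
  interpret xs: Vector_Spaces.linear scale "(*)" "xs n" using assms by (simp add: is_dual_sequence_def)
  interpret ys: Vector_Spaces.linear scale "(*)" "ys n" using assms by (simp add: is_dual_sequence_def)
  obtain C where C: "C \<ge> 0" "\<And>f. norm (xs n f) \<le> C * q f" 
    using dual_sequence_bounded[OF assms(2)] by blast
  obtain C' where C': "C' \<ge> 0" "\<And>f. norm (ys n f) \<le> C' * q f" 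
    using dual_sequence_bounded[OF assms(3)] by blast
  have eq: "xs n g = ys n g" if "g \<in> span (range x)" for g
    using that
  proof (induction rule: span_induct_alt)
    case (step c u v)
    then obtain k where "u = x k" by blast
    then have "xs n u = ys n u" using assms(2,3) by (simp add: is_dual_sequence_def)
    with step show ?case by (simp add: xs.add ys.add xs.scale ys.scale)
  qed simp
  have "norm (xs n f - ys n f) \<le> 0 + e" if "0 < e" for e
  proof -
    have e': "0 < e / (C + C' + 1)" using that C C' by simp
    then obtain g where g: "g \<in> span (range x)" "q (f - g) < e / (C + C' + 1)"
      using assms(1) unfolding is_basis_def by blast
    have "xs n f - ys n f = xs n (f - g) - ys n (f - g)"
      by (simp add: xs.diff ys.diff eq[OF g(1)])
    also have "norm \<dots> \<le> norm (xs n (f - g)) + norm (ys n (f - g))" by (rule norm_triangle_ineq4)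
    also have "\<dots> \<le> C * q (f - g) + C' * q (f - g)" using C C' by (intro add_mono) auto
    also have "\<dots> \<le> (C + C' + 1) * q (f - g)" using q_nonneg[of "f - g"] by (simp add: algebra_simps)
    also have "\<dots> \<le> e" using g(2) C C' by (simp add: field_simps)
    finally show ?thesis by simp
  qed
  then have "norm (xs n f - ys n f) \<le> 0" by (rule field_le_epsilon)
  then show "xs n f = ys n f" by simp
qed

lemma dual_basis_eq:
  assumes "is_basis scale q x" and "is_dual_sequence scale q x xs"
  shows "dual_basis scale q x = xs"
  unfolding dual_basis_def
  by (rule the_equality, rule assms(2)) (rule dual_sequence_unique[OF assms(1) _ assms(2)])

lemma is_dual_sequence_dual_basis:
  assumes "is_basis scale q x"
  shows "is_dual_sequence scale q x (dual_basis scale q x)"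
proof -
  obtain xs where "is_dual_sequence scale q x xs" using assms unfolding is_basis_def by blast
  with dual_basis_eq[OF assms this] show ?thesis by simp
qed

section \<open>Estimates for bidemocratic bases\<close>

text \<open>Testing both suprema on single sets and on one vector of the unit ball turns bidemocracy
  into an inequality between reals.\<close>

lemma bidemocratic_product_le:
  assumes "bidemocratic_basis scale q x"
  obtains \<Delta> where "0 \<le> \<Delta>"
    and "\<And>A B f m. finite A \<Longrightarrow> finite B \<Longrightarrow> card A \<le> m \<Longrightarrow> card B \<le> m \<Longrightarrow> q f \<le> 1 \<Longrightarrow>
           q (\<Sum>k\<in>A. x k) * norm (\<Sum>k\<in>B. dual_basis scale q x k f) \<le> \<Delta> * real m"
proof -
  obtain \<Delta> where \<Delta>: "\<And>m. phi q x m * phi_dual scale q x m \<le> ennreal \<Delta> * of_nat m"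
    using assms unfolding bidemocratic_basis_def by blast
  have bound: "q (\<Sum>k\<in>A. x k) * norm (\<Sum>k\<in>B. dual_basis scale q x k f) \<le> max \<Delta> 0 * real m"
    if "finite A" "finite B" "card A \<le> m" "card B \<le> m" "q f \<le> 1" for A B f m
  proof -
    let ?a = "q (\<Sum>k\<in>A. x k)" and ?b = "norm (\<Sum>k\<in>B. dual_basis scale q x k f)"
    have "ennreal ?a \<le> phi q x m" unfolding phi_def by (rule SUP_upper) (use that in simp)
    moreover have "ennreal ?b \<le> phi_dual scale q x m"
      unfolding phi_dual_def using that
      by (intro SUP_upper2[of B] ennreal_norm_le_dual_norm[where F = "\<lambda>f. \<Sum>k\<in>B. dual_basis scale q x k f"]) auto
    ultimately have "ennreal ?a * ennreal ?b \<le> phi q x m * phi_dual scale q x m" by (rule mult_mono) auto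
    also have "\<dots> \<le> ennreal \<Delta> * of_nat m" by (rule \<Delta>)
    also have "\<dots> \<le> ennreal (max \<Delta> 0) * of_nat m" by (intro mult_right_mono ennreal_leI) auto
    finally have "ennreal (?a * ?b) \<le> ennreal (max \<Delta> 0 * real m)"
      by (simp add: ennreal_mult q_nonneg ennreal_of_nat_eq_real_of_nat)
    then show ?thesis by (subst (asm) ennreal_le_iff) auto
  qed
  show thesis by (rule that[OF _ bound]) simp
qed

text \<open>Coefficients of size at least \<open>t\<close> on \<open>B\<close> have absolute values
  summing to at least \<open>t * card B\<close>, while their subset sums are controlled by the dual
  fundamental function. Bidemocracy then gives \<open>q (sum x A) \<le> 4 * \<Delta> / t\<close> for
  every \<open>A\<close> inside \<open>R\<close>, and coefficients of size at most
  \<open>M * t\<close> cancel the \<open>t\<close>.\<close>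

lemma bidemocratic_truncation:
  assumes "bidemocratic_basis scale q x"
  obtains C where "0 \<le> C"
    and "\<And>R B d t f M. finite R \<Longrightarrow> finite B \<Longrightarrow> card R \<le> card B \<Longrightarrow> q f \<le> 1 \<Longrightarrow> 0 \<le> M \<Longrightarrow> 0 \<le> t \<Longrightarrow>
           (\<And>n. n \<in> B \<Longrightarrow> t \<le> norm (dual_basis scale q x n f)) \<Longrightarrow> (\<And>n. n \<in> R \<Longrightarrow> norm (d n) \<le> M * t) \<Longrightarrow>
           q (\<Sum>n\<in>R. scale (d n) (x n)) \<le> C * M"
proof -
  let ?xs = "dual_basis scale q x"
  obtain \<Delta> where \<Delta>0: "\<Delta> \<ge> 0" and \<Delta>: "\<And>A B f m. finite A \<Longrightarrow> finite B \<Longrightarrow> card A \<le> m \<Longrightarrow> card B \<le> m \<Longrightarrow> q f \<le> 1 \<Longrightarrow>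
           q (\<Sum>k\<in>A. x k) * norm (\<Sum>k\<in>B. ?xs k f) \<le> \<Delta> * real m"
    by (rule bidemocratic_product_le[OF assms]) blast
  obtain K where K0: "K \<ge> 0" and K: "\<And>(R::nat set) v P d t. finite R \<Longrightarrow> (\<And>A. A \<subseteq> R \<Longrightarrow> q (sum v A) \<le> P) \<Longrightarrow>
     (\<And>n. n \<in> R \<Longrightarrow> norm (d n) \<le> t) \<Longrightarrow> 0 \<le> t \<Longrightarrow> q (\<Sum>n\<in>R. scale (d n) (v n)) \<le> K * (t * P)"
    by (rule q_bounded_coeffs_le) blast
  show thesis
  proof (rule that)
    show "0 \<le> K * (4 * \<Delta>)" using K0 \<Delta>0 by simp
  next
    fix R B :: "nat set" and d :: "nat \<Rightarrow> 'k" and t f M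
    assume R: "finite R" and B: "finite B" and card: "card R \<le> card B" and f: "q f \<le> 1" and M: "0 \<le> M"
      and t0: "0 \<le> t" and t: "\<And>n. n \<in> B \<Longrightarrow> t \<le> norm (?xs n f)" and d: "\<And>n. n \<in> R \<Longrightarrow> norm (d n) \<le> M * t"
    show "q (\<Sum>n\<in>R. scale (d n) (x n)) \<le> K * (4 * \<Delta>) * M"
    proof (cases "t = 0 \<or> R = {}")
      case True
      then have "(\<Sum>n\<in>R. scale (d n) (x n)) = 0" using d by (intro sum.neutral) auto
      then show ?thesis using K0 \<Delta>0 M by simp
    next
      case False
      then have t_pos: "0 < t" and m: "0 < card B" using t0 R card card_gt_0_iff[of R] by auto
      have A: "q (sum x A) \<le> 4 * \<Delta> / t" if A: "A \<subseteq> R" for A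
      proof -
        have A': "finite A" "card A \<le> card B"
          using A R card card_mono[OF R A] finite_subset by auto
        \<comment> \<open>Bidemocracy bounds only the product, so the factor
          \<open>q (sum x A)\<close> is carried inside the sum.\<close>
        have "(\<Sum>n\<in>B. norm (of_real (q (sum x A)) * ?xs n f)) \<le> 4 * (\<Delta> * card B)"
        proof (rule sum_norm_le_subset_sums[OF B])
          fix B' assume "B' \<subseteq> B"
          then show "norm (\<Sum>n\<in>B'. of_real (q (sum x A)) * ?xs n f) \<le> \<Delta> * card B"
            using \<Delta>[OF A'(1) _ A'(2) card_mono[OF B] f] finite_subset[OF _ B]
            by (simp add: norm_mult q_nonneg flip: sum_distrib_left)
        qed
        moreover have "card B * (q (sum x A) * t) \<le> (\<Sum>n\<in>B. norm (of_real (q (sum x A)) * ?xs n f))"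
          using t by (intro sum_bounded_below) (simp add: norm_mult q_nonneg mult_left_mono)
        ultimately have "card B * (q (sum x A) * t) \<le> card B * (4 * \<Delta>)" by (simp add: mult_ac)
        then show ?thesis using m t_pos by (simp add: field_simps)
      qed
      have "q (\<Sum>n\<in>R. scale (d n) (x n)) \<le> K * ((M * t) * (4 * \<Delta> / t))"
        by (rule K[OF R A]) (use M t0 d in auto)
      then show ?thesis using t_pos by (simp add: field_simps)
    qed
  qed
qed

text \<open>The \<open>card A div 2\<close> largest coefficients are kept. The discarded ones are
  dominated by them and about equal in number, so truncation bounds their sum. This compensates for
  the doubling of cardinalities in the diamond.\<close>

lemma greedy_set_halving:
  assumes "bidemocratic_basis scale q x"
  obtains C where "0 \<le> C"
    and "\<And>A f. greedy_set scale q x f A \<Longrightarrow> q f \<le> 1 \<Longrightarrow>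
           (\<exists>A1. greedy_set scale q x f A1 \<and> 2 * card A1 \<le> card A \<and>
                 q (coord_proj scale q x A f) \<le> C * (1 + q (coord_proj scale q x A1 f)))"
proof -
  let ?xs = "dual_basis scale q x"
  obtain C where C0: "C \<ge> 0" and C: "\<And>R B d t f M. finite R \<Longrightarrow> finite B \<Longrightarrow> card R \<le> card B \<Longrightarrow> q f \<le> 1 \<Longrightarrow>
      0 \<le> M \<Longrightarrow> 0 \<le> t \<Longrightarrow>
           (\<And>n. n \<in> B \<Longrightarrow> t \<le> norm (?xs n f)) \<Longrightarrow> (\<And>n. n \<in> R \<Longrightarrow> norm (d n) \<le> M * t) \<Longrightarrow>
           q (\<Sum>n\<in>R. scale (d n) (x n)) \<le> C * M"
    by (rule bidemocratic_truncation[OF assms]) blast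
  have bound: "\<exists>A1. greedy_set scale q x f A1 \<and> 2 * card A1 \<le> card A \<and>
      q (coord_proj scale q x A f) \<le> kappa * (1 + C) * (1 + q (coord_proj scale q x A1 f))"
    if A: "greedy_set scale q x f A" and f: "q f \<le> 1" for A f
  proof -
    let ?v = "\<lambda>n. norm (?xs n f)"
    have fin: "finite A" using A by (simp add: greedy_set_def)
    obtain A1 where A1: "A1 \<subseteq> A" "card A1 = card A div 2" "\<And>n k. n \<in> A1 \<Longrightarrow> k \<in> A - A1 \<Longrightarrow> ?v k \<le> ?v n"
      using exists_top_subset[OF fin, of "card A div 2" ?v] by auto
    have fin1: "finite A1" using A1(1) fin by (rule finite_subset)
    have greedy: "greedy_set scale q x f A1"
      using A A1 fin1 unfolding greedy_set_def by blast
    have rest: "q (\<Sum>n\<in>A - A1. scale (?xs n f) (x n)) \<le> C"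
    proof (cases "A - A1 = {}")
      case True
      then show ?thesis using C0 by (simp only: sum.empty q_0)
    next
      case False
      with fin obtain j where j: "j \<in> A - A1" "\<And>k. k \<in> A - A1 \<Longrightarrow> ?v k \<le> ?v j"
        using finite_obtain_max[of "A - A1" ?v] by blast
      \<comment> \<open>For odd \<open>card A\<close> the rest has one element more than
        \<open>A1\<close>. The comparison set is therefore \<open>A1\<close> together with the index
        \<open>j\<close> of the largest discarded coefficient, and the threshold is the value at
        \<open>j\<close>.\<close>
      have "card (A - A1) = card A - card A div 2" using A1 fin1 by (simp add: card_Diff_subset)
      also have "\<dots> \<le> Suc (card A div 2)" by linarith
      also have "\<dots> = card (insert j A1)" using j(1) fin1 A1(2) by simp
      finally have "q (\<Sum>n\<in>A - A1. scale (?xs n f) (x n)) \<le> C * 1"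
        using j A1(3) fin fin1 f by (intro C[of _ "insert j A1" _ _ "?v j"]) auto
      then show ?thesis by simp
    qed
    have "coord_proj scale q x A f = coord_proj scale q x A1 f + (\<Sum>n\<in>A - A1. scale (?xs n f) (x n))"
      unfolding coord_proj_def by (subst sum.subset_diff[OF A1(1) fin]) (simp add: add.commute)
    also have "q \<dots> \<le> kappa * (q (coord_proj scale q x A1 f) + C)" (is "_ \<le> kappa * (?q + C)")
      by (rule q_add_le_bounds[OF order_refl rest])
    also have "\<dots> \<le> kappa * ((1 + C) * (1 + ?q))"
      using kappa_ge_1 C0 q_nonneg[of "coord_proj scale q x A1 f"]
      by (intro mult_left_mono) (auto simp: algebra_simps)
    finally show ?thesis using greedy A1(2) by (intro exI[of _ A1]) (auto simp: mult.assoc)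
  qed
  have "0 \<le> kappa * (1 + C)" using C0 kappa_ge_1 by simp
  then show thesis using bound by (rule that)
qed

section \<open>Elementary bounds for the greedy parameters\<close>

lemma le_g_param:
  assumes "greedy_set scale q x f A" and "q f \<le> 1" and "card A \<le> m"
  shows "ennreal (q (coord_proj scale q x A f)) \<le> g_param scale q x m"
proof -
  have "ennreal (q (coord_proj scale q x A f)) \<le> g_bar scale q x (card A)"
    unfolding g_bar_def by (rule SUP_upper2[of "(A, f)"]) (use assms in auto)
  also have "\<dots> \<le> g_param scale q x m"
    unfolding g_param_def by (rule SUP_upper) (use assms in simp)
  finally show ?thesis .
qed

lemma g_param_le:
  assumes "\<And>A f. greedy_set scale q x f A \<Longrightarrow> q f \<le> 1 \<Longrightarrow> card A \<le> m \<Longrightarrow>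
             ennreal (q (coord_proj scale q x A f)) \<le> c"
  shows "g_param scale q x m \<le> c"
  unfolding g_param_def g_bar_def by (intro SUP_least) (use assms in auto)

text \<open>This settles \<open>m = 0\<close>, where the bound of \<open>one_le_g_param\<close>
  fails: both sides of the equivalence vanish.\<close>

lemma g_param_0: "g_param scale q x 0 = 0"
proof -
  have "g_param scale q x 0 \<le> 0"
    by (rule g_param_le) (simp add: greedy_set_def coord_proj_def)
  then show ?thesis by simp
qed

text \<open>The normalised first basis vector is its own projection onto the greedy set
  \<open>{0}\<close>. The lower bound 1 later absorbs additive constants.\<close>

lemma one_le_g_param:
  assumes "is_basis scale q x" and "0 < m"
  shows "1 \<le> g_param scale q x m"
proof -
  let ?xs = "dual_basis scale q x"
  have dual: "is_dual_sequence scale q x ?xs" by (rule is_dual_sequence_dual_basis[OF assms(1)])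
  interpret xs0: Vector_Spaces.linear scale "(*)" "?xs 0" using dual by (simp add: is_dual_sequence_def)
  have xs: "?xs n (x 0) = (if n = 0 then 1 else 0)" for n
    using dual by (simp add: is_dual_sequence_def)
  have "x 0 \<noteq> 0" using xs[of 0] xs0.zero by auto
  then have q: "0 < q (x 0)" using q_eq_0_iff q_nonneg[of "x 0"] by (simp add: less_le)
  let ?f = "scale (of_real (1 / q (x 0))) (x 0)"
  have xsf: "?xs n ?f = (if n = 0 then of_real (1 / q (x 0)) else 0)" for n
  proof -
    interpret xsn: Vector_Spaces.linear scale "(*)" "?xs n" using dual by (simp add: is_dual_sequence_def)
    show ?thesis by (simp add: xsn.scale xs)
  qed
  have qf: "q ?f = 1" using q by (simp add: q_scale norm_divide)
  have "greedy_set scale q x ?f {0}" unfolding greedy_set_def xsf by auto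
  then have "ennreal (q (coord_proj scale q x {0} ?f)) \<le> g_param scale q x m"
    by (rule le_g_param) (use qf assms(2) in auto)
  moreover have "coord_proj scale q x {0} ?f = ?f" unfolding coord_proj_def xsf by simp
  ultimately show ?thesis using qf by simp
qed

end

section \<open>Truncation across the two spaces\<close>

text \<open>Truncation in the second space bounds \<open>phi_u scaleY qY y (card R)\<close> by
  \<open>C / t\<close>. The domination carries this over to \<open>x\<close>, and bounded
  coefficients are then treated as within one space.\<close>

lemma phi_u_domination_truncation:
  fixes scaleX :: "'k::real_or_complex \<Rightarrow> 'v::ab_group_add \<Rightarrow> 'v"
    and scaleY :: "'k \<Rightarrow> 'w::ab_group_add \<Rightarrow> 'w"
  assumes "quasi_banach scaleX qX" and "quasi_banach scaleY qY" and "bidemocratic_basis scaleY qY y"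
    and dom: "\<And>m. phi_u scaleX qX x m \<le> ennreal c * phi_u scaleY qY y m"
  obtains C where "0 \<le> C"
    and "\<And>R d t g M. finite R \<Longrightarrow> qY g \<le> 1 \<Longrightarrow> 0 \<le> M \<Longrightarrow> 0 \<le> t \<Longrightarrow>
           (\<And>n. n \<in> R \<Longrightarrow> t \<le> norm (dual_basis scaleY qY y n g)) \<Longrightarrow> (\<And>n. n \<in> R \<Longrightarrow> norm (d n) \<le> M * t) \<Longrightarrow>
           qX (\<Sum>n\<in>R. scaleX (d n) (x n)) \<le> C * M"
proof -
  interpret X: quasi_banach scaleX qX by fact
  interpret Y: quasi_banach scaleY qY by fact
  obtain C where C0: "C \<ge> 0" and C: "\<And>R B d t f M. finite R \<Longrightarrow> finite B \<Longrightarrow> card R \<le> card B \<Longrightarrow> qY f \<le> 1 \<Longrightarrow>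
      0 \<le> M \<Longrightarrow> 0 \<le> t \<Longrightarrow>
           (\<And>n. n \<in> B \<Longrightarrow> t \<le> norm (dual_basis scaleY qY y n f)) \<Longrightarrow> (\<And>n. n \<in> R \<Longrightarrow> norm (d n) \<le> M * t) \<Longrightarrow>
           qY (\<Sum>n\<in>R. scaleY (d n) (y n)) \<le> C * M"
    by (rule Y.bidemocratic_truncation[OF assms(3)]) blast
  obtain K where K0: "K \<ge> 0" and K: "\<And>(R::nat set) v P d t. finite R \<Longrightarrow> (\<And>A. A \<subseteq> R \<Longrightarrow> qX (sum v A) \<le> P) \<Longrightarrow>
     (\<And>n. n \<in> R \<Longrightarrow> norm (d n) \<le> t) \<Longrightarrow> 0 \<le> t \<Longrightarrow> qX (\<Sum>n\<in>R. scaleX (d n) (v n)) \<le> K * (t * P)"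
    by (rule X.q_bounded_coeffs_le) blast
  define C1 where "C1 = max c 0"
  show thesis
  proof (rule that[of "K * (C1 * C)"])
    show "0 \<le> K * (C1 * C)" using K0 C0 by (simp add: C1_def)
  next
    fix R :: "nat set" and d :: "nat \<Rightarrow> 'k" and t g M
    assume R: "finite R" and g: "qY g \<le> 1" and M: "0 \<le> M" and t0: "0 \<le> t"
      and t: "\<And>n. n \<in> R \<Longrightarrow> t \<le> norm (dual_basis scaleY qY y n g)" and d: "\<And>n. n \<in> R \<Longrightarrow> norm (d n) \<le> M * t"
    show "qX (\<Sum>n\<in>R. scaleX (d n) (x n)) \<le> K * (C1 * C) * M"
    proof (cases "t = 0")
      case True
      then have "(\<Sum>n\<in>R. scaleX (d n) (x n)) = 0" using d by (intro sum.neutral) auto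
      then show ?thesis using K0 C0 M by (simp add: C1_def)
    next
      case False
      then have t_pos: "0 < t" using t0 by simp
      have "phi_u scaleY qY y (card R) \<le> ennreal (C / t)"
        unfolding phi_u_def
      proof (rule SUP_least, clarify)
        fix A :: "nat set" and \<epsilon> :: "nat \<Rightarrow> 'k"
        assume A: "finite A" "card A \<le> card R" and \<epsilon>: "\<forall>n\<in>A. norm (\<epsilon> n) = 1"
        \<comment> \<open>Multiplied by \<open>t\<close>, the signs become coefficients of absolute
          value \<open>t\<close>, so truncation applies with \<open>M = 1\<close>.\<close>
        have "qY (\<Sum>n\<in>A. scaleY (of_real t * \<epsilon> n) (y n)) \<le> C * 1"
          by (rule C[OF A(1) R A(2) g _ t0 t]) (use \<epsilon> t0 in \<open>auto simp: norm_mult\<close>)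
        moreover have "(\<Sum>n\<in>A. scaleY (of_real t * \<epsilon> n) (y n)) = scaleY (of_real t) (\<Sum>n\<in>A. scaleY (\<epsilon> n) (y n))"
          by (simp add: Y.scale_sum_right)
        ultimately have "t * qY (\<Sum>n\<in>A. scaleY (\<epsilon> n) (y n)) \<le> C" using t0 by (simp add: Y.q_scale)
        then show "ennreal (qY (\<Sum>n\<in>A. scaleY (\<epsilon> n) (y n))) \<le> ennreal (C / t)"
          using t_pos by (intro ennreal_leI) (simp add: field_simps)
      qed
      then have phi_bound: "phi_u scaleX qX x (card R) \<le> ennreal C1 * ennreal (C / t)"
        by (intro order_trans[OF dom] mult_mono ennreal_leI) (auto simp: C1_def)
      have A: "qX (sum x A) \<le> C1 * (C / t)" if "A \<subseteq> R" for A
      proof -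
        \<comment> \<open>The plain sum is the one with constant sign 1.\<close>
        have "ennreal (qX (\<Sum>n\<in>A. scaleX 1 (x n))) \<le> phi_u scaleX qX x (card R)"
          unfolding phi_u_def using that R
          by (intro SUP_upper2[of "(A, \<lambda>_. 1)"]) (auto intro: finite_subset card_mono)
        also note phi_bound
        also have "ennreal C1 * ennreal (C / t) = ennreal (C1 * (C / t))"
          by (rule ennreal_mult[symmetric]) (use C0 t0 in \<open>auto simp: C1_def\<close>)
        finally show ?thesis
          using C0 t0 by (subst (asm) ennreal_le_iff) (auto simp: C1_def)
      qed
      have "qX (\<Sum>n\<in>R. scaleX (d n) (x n)) \<le> K * ((M * t) * (C1 * (C / t)))"
        by (rule K[OF R A]) (use M t0 d in auto)
      then show ?thesis using t_pos by (simp add: field_simps)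
    qed
  qed
qed

section \<open>The diamond of two bases\<close>

definition alt_coeffs :: "(nat \<Rightarrow> 'k::real_or_complex) \<Rightarrow> (nat \<Rightarrow> 'k) \<Rightarrow> nat \<Rightarrow> 'k" where
  "alt_coeffs a b i = (if even i then a (i div 2) + b (i div 2) else a (i div 2) - b (i div 2))"

definition pair_coeff :: "nat set \<Rightarrow> (nat \<Rightarrow> 'k::real_or_complex) \<Rightarrow> (nat \<Rightarrow> 'k) \<Rightarrow> nat \<Rightarrow> 'k" where
  "pair_coeff D a b n =
     ((if 2 * n \<in> D then a n + b n else 0) + (if Suc (2 * n) \<in> D then a n - b n else 0)) / 2"

text \<open>Up to the factor \<open>1 / sqrt 2\<close>, \<open>alt_coeffs a b\<close> are the coefficients of \<open>(f, g)\<close> in the diamond basis,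
  and the projection of \<open>(f, g)\<close> onto \<open>D\<close> has the coefficients \<open>pair_coeff D a b\<close> and
  \<open>pair_coeff D b a\<close>.\<close>

lemma norm_alt_coeffs_commute: "norm (alt_coeffs a b i) = norm (alt_coeffs b a i)"
  by (simp add: alt_coeffs_def add.commute norm_minus_commute)

lemma alt_coeffs_simps [simp]:
  "alt_coeffs a b (2 * n) = a n + b n" "alt_coeffs a b (Suc (2 * n)) = a n - b n"
  by (simp_all add: alt_coeffs_def)

lemma mem_div_2_image_iff: "n \<in> (\<lambda>i. i div 2) ` D \<longleftrightarrow> 2 * n \<in> D \<or> Suc (2 * n) \<in> D"
proof
  assume "n \<in> (\<lambda>i. i div 2) ` D"
  then obtain i where "i \<in> D" "n = i div 2" by blast
  moreover have "i = 2 * (i div 2) \<or> i = Suc (2 * (i div 2))" by presburger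
  ultimately show "2 * n \<in> D \<or> Suc (2 * n) \<in> D" by metis
qed force

lemma sum_over_pairs:
  fixes F :: "nat \<Rightarrow> 'v::ab_group_add"
  assumes "finite D"
  shows "sum F D = (\<Sum>n\<in>(\<lambda>i. i div 2) ` D.
           (if 2 * n \<in> D then F (2 * n) else 0) + (if Suc (2 * n) \<in> D then F (Suc (2 * n)) else 0))"
proof -
  have "sum F D = (\<Sum>n\<in>(\<lambda>i. i div 2) ` D. sum F {i \<in> D. i div 2 = n})"
    by (rule sum.image_gen[OF assms])
  also have "\<dots> = (\<Sum>n\<in>(\<lambda>i. i div 2) ` D. sum F {i \<in> {2 * n, Suc (2 * n)}. i \<in> D})"
  proof (rule sum.cong[OF refl])
    fix n
    have "{i \<in> D. i div 2 = n} = {i \<in> {2 * n, Suc (2 * n)}. i \<in> D}" by auto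
    then show "sum F {i \<in> D. i div 2 = n} = sum F {i \<in> {2 * n, Suc (2 * n)}. i \<in> D}" by simp
  qed
  also have "\<dots> = (\<Sum>n\<in>(\<lambda>i. i div 2) ` D.
      (if 2 * n \<in> D then F (2 * n) else 0) + (if Suc (2 * n) \<in> D then F (Suc (2 * n)) else 0))"
    by (subst sum.inter_filter) simp_all
  finally show ?thesis .
qed

text \<open>\<open>a n\<close> is the mean of the two coefficients of its pair. If both indices lie
  in \<open>D\<close>, nothing is lost; otherwise exactly one is missing, and its coefficient, of
  size at most \<open>s\<close>, enters with the factor 1/2.\<close>

lemma norm_pair_coeff_diff_le:
  assumes "n \<in> (\<lambda>i. i div 2) ` D"
    and "\<And>k. k \<notin> D \<Longrightarrow> norm (alt_coeffs a b k) \<le> s" and "0 \<le> s"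
  shows "norm (pair_coeff D a b n - a n) \<le> s / 2"
proof -
  have plus: "norm (a n + b n) \<le> s" if "2 * n \<notin> D" using assms(2)[OF that] by simp
  have minus: "norm (a n - b n) \<le> s" if "Suc (2 * n) \<notin> D" using assms(2)[OF that] by simp
  consider "2 * n \<in> D" "Suc (2 * n) \<in> D" | "2 * n \<in> D" "Suc (2 * n) \<notin> D" | "2 * n \<notin> D" "Suc (2 * n) \<in> D"
    using assms(1) mem_div_2_image_iff by blast
  then show ?thesis
  proof cases
    case 1
    then show ?thesis using assms(3) by (simp add: pair_coeff_def)
  next
    case 2
    then have "pair_coeff D a b n - a n = - ((a n - b n) / 2)" by (simp add: pair_coeff_def field_simps)
    then show ?thesis using minus[OF 2(2)] by (simp only: norm_minus_cancel norm_divide) simp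
  next
    case 3
    then have "pair_coeff D a b n - a n = - ((a n + b n) / 2)" by (simp add: pair_coeff_def field_simps)
    then show ?thesis using plus[OF 3(1)] by (simp only: norm_minus_cancel norm_divide) simp
  qed
qed

text \<open>Applied twice, with the spaces exchanged, this covers both components. \<open>A\<close>
  consists of indices met by \<open>D\<close>, whence its cardinality. The remainder is bounded by
  truncation in the first space where the coefficients of \<open>f\<close> are large, and by
  transfer from the second space elsewhere.\<close>

lemma diamond_greedy_component_le:
  fixes scaleX :: "'k::real_or_complex \<Rightarrow> 'v::ab_group_add \<Rightarrow> 'v"
    and scaleY :: "'k \<Rightarrow> 'w::ab_group_add \<Rightarrow> 'w"
  assumes "quasi_banach scaleX qX" and "quasi_banach scaleY qY"
    and "bidemocratic_basis scaleX qX x" and "bidemocratic_basis scaleY qY y"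
    and "\<And>m. phi_u scaleX qX x m \<le> ennreal c * phi_u scaleY qY y m"
  obtains C where "0 \<le> C"
    and "\<And>D f g a b. finite D \<Longrightarrow> D \<noteq> {} \<Longrightarrow> qX f \<le> 1 \<Longrightarrow> qY g \<le> 1 \<Longrightarrow>
          a = (\<lambda>n. dual_basis scaleX qX x n f) \<Longrightarrow> b = (\<lambda>n. dual_basis scaleY qY y n g) \<Longrightarrow>
          (\<And>i k. i \<in> D \<Longrightarrow> k \<notin> D \<Longrightarrow> norm (alt_coeffs a b k) \<le> norm (alt_coeffs a b i)) \<Longrightarrow>
          \<exists>A. greedy_set scaleX qX x f A \<and> card A \<le> card D \<and>
            qX (\<Sum>n\<in>(\<lambda>i. i div 2) ` D. scaleX (pair_coeff D a b n) (x n))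
              \<le> C * (1 + qX (coord_proj scaleX qX x A f))"
proof -
  interpret X: quasi_banach scaleX qX by fact
  obtain C1 where C1: "C1 \<ge> 0" and trX: "\<And>R B d t f M. finite R \<Longrightarrow> finite B \<Longrightarrow> card R \<le> card B \<Longrightarrow>
      qX f \<le> 1 \<Longrightarrow> 0 \<le> M \<Longrightarrow> 0 \<le> t \<Longrightarrow>
           (\<And>n. n \<in> B \<Longrightarrow> t \<le> norm (dual_basis scaleX qX x n f)) \<Longrightarrow> (\<And>n. n \<in> R \<Longrightarrow> norm (d n) \<le> M * t) \<Longrightarrow>
           qX (\<Sum>n\<in>R. scaleX (d n) (x n)) \<le> C1 * M"
    by (rule X.bidemocratic_truncation[OF assms(3)]) blast
  obtain C2 where C2: "C2 \<ge> 0" and trY: "\<And>R d t g M. finite R \<Longrightarrow> qY g \<le> 1 \<Longrightarrow> 0 \<le> M \<Longrightarrow> 0 \<le> t \<Longrightarrow>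
           (\<And>n. n \<in> R \<Longrightarrow> t \<le> norm (dual_basis scaleY qY y n g)) \<Longrightarrow> (\<And>n. n \<in> R \<Longrightarrow> norm (d n) \<le> M * t) \<Longrightarrow>
           qX (\<Sum>n\<in>R. scaleX (d n) (x n)) \<le> C2 * M"
    by (rule phi_u_domination_truncation[OF assms(1,2,4,5)]) blast
  define L where "L = X.kappa * (C1 * 3 + C2 * 3)"
  have L: "0 \<le> L" using C1 C2 X.kappa_ge_1 by (simp add: L_def)
  show thesis
  proof (rule that[of "X.kappa * (1 + L)"])
    show "0 \<le> X.kappa * (1 + L)" using L X.kappa_ge_1 by simp
  next
    fix D :: "nat set" and f g and a b :: "nat \<Rightarrow> 'k"
    assume D: "finite D" "D \<noteq> {}" and f: "qX f \<le> 1" and g: "qY g \<le> 1"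
      and a: "a = (\<lambda>n. dual_basis scaleX qX x n f)" and b: "b = (\<lambda>n. dual_basis scaleY qY y n g)"
      and greedy: "\<And>i k. i \<in> D \<Longrightarrow> k \<notin> D \<Longrightarrow> norm (alt_coeffs a b k) \<le> norm (alt_coeffs a b i)"
    \<comment> \<open>Maximising the negatives yields an index of the least value on
      \<open>D\<close>.\<close>
    obtain i0 where "i0 \<in> D" and i0: "\<And>k. k \<in> D \<Longrightarrow> - norm (alt_coeffs a b k) \<le> - norm (alt_coeffs a b i0)"
      by (rule finite_obtain_max[OF D, of "\<lambda>i. - norm (alt_coeffs a b i)"]) blast
    define s where "s = norm (alt_coeffs a b i0)"
    have s0: "0 \<le> s" by (simp add: s_def)
    have inD: "s \<le> norm (alt_coeffs a b i)" if "i \<in> D" for i using i0[OF that] by (simp add: s_def)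
    have outD: "norm (alt_coeffs a b k) \<le> s" if "k \<notin> D" for k
      unfolding s_def by (rule greedy[OF \<open>i0 \<in> D\<close> that])
    define D0 where "D0 = (\<lambda>i. i div 2) ` D"
    have D0: "finite D0" "card D0 \<le> card D" using D by (simp_all add: D0_def card_image_le)
    define A where "A = {n. s < norm (a n)}"
    \<comment> \<open>Neither index of the pair lies in \<open>D\<close>, and \<open>2 * a n\<close>
      is the sum of their two coefficients, each of size at most \<open>s\<close>. The strict
      inequality in \<open>A\<close> then places \<open>A\<close> inside \<open>D0\<close>.\<close>
    have "norm (a n) \<le> s" if "n \<notin> D0" for n
    proof -
      have "2 * n \<notin> D" "Suc (2 * n) \<notin> D" using that mem_div_2_image_iff unfolding D0_def by blast+
      then have "norm (a n + b n) \<le> s" "norm (a n - b n) \<le> s" using outD by force+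
      moreover have "2 * norm (a n) = norm ((a n + b n) + (a n - b n))"
          by (simp flip: mult_2 add: norm_mult)
      ultimately show ?thesis using norm_triangle_ineq[of "a n + b n" "a n - b n"] by linarith
    qed
    then have AD: "A \<subseteq> D0" unfolding A_def by force
    then have A: "finite A" "card A \<le> card D" using D0 finite_subset card_mono[of D0 A] by auto
    have A_greedy: "greedy_set scaleX qX x f A"
      using A(1) unfolding greedy_set_def A_def a by force
    define d where "d n = pair_coeff D a b n - (if n \<in> A then a n else 0)" for n
    \<comment> \<open>On \<open>A\<close> the error is at most \<open>s / 2\<close>; off
      \<open>A\<close> the coefficient \<open>a n\<close>, of size at most \<open>s\<close>, is
      added. The form \<open>3 * (s / 2)\<close> fits truncation with \<open>M = 3\<close> at level
      \<open>s / 2\<close>.\<close>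
    have d: "norm (d n) \<le> 3 * (s / 2)" if "n \<in> D0" for n
    proof (cases "n \<in> A")
      case True
      then show ?thesis
        using norm_pair_coeff_diff_le[OF that[unfolded D0_def] outD s0] s0 by (simp add: d_def)
    next
      case False
      have "norm (pair_coeff D a b n) \<le> norm (pair_coeff D a b n - a n) + norm (a n)"
        using norm_triangle_ineq[of "pair_coeff D a b n - a n" "a n"] by simp
      then show ?thesis
        using norm_pair_coeff_diff_le[OF that[unfolded D0_def] outD s0] False by (simp add: d_def A_def)
    qed
    define Da where "Da = {n \<in> D0. s / 2 \<le> norm (a n)}"
    \<comment> \<open>At least one index of the pair lies in \<open>D\<close>, so the absolute
      values of \<open>a n\<close> and \<open>b n\<close> add up to at least \<open>s\<close>: a
      small \<open>a n\<close> forces a large \<open>b n\<close>.\<close>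
    have large_b: "s / 2 \<le> norm (b n)" if "n \<in> D0 - Da" for n
    proof -
      have "s \<le> norm (a n + b n) \<or> s \<le> norm (a n - b n)"
        using that mem_div_2_image_iff[of n D] inD[of "2 * n"] inD[of "Suc (2 * n)"]
            by (auto simp: D0_def)
      then have "s \<le> norm (a n) + norm (b n)"
        using norm_triangle_ineq[of "a n" "b n"] norm_triangle_ineq4[of "a n" "b n"] by linarith
      then show ?thesis using that by (auto simp: Da_def)
    qed
    have rest_a: "qX (\<Sum>n\<in>Da. scaleX (d n) (x n)) \<le> C1 * 3"
      by (rule trX[of Da Da f 3 "s / 2"]) (use D0(1) f s0 d in \<open>auto simp: Da_def a\<close>)
    have rest_b: "qX (\<Sum>n\<in>D0 - Da. scaleX (d n) (x n)) \<le> C2 * 3"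
      by (rule trY[of "D0 - Da" g 3 "s / 2"]) (use D0(1) g s0 d large_b in \<open>auto simp: b\<close>)
    have "(\<Sum>n\<in>D0. scaleX (d n) (x n)) = (\<Sum>n\<in>Da. scaleX (d n) (x n)) + (\<Sum>n\<in>D0 - Da. scaleX (d n) (x n))"
      by (subst sum.subset_diff[OF _ D0(1), of Da]) (auto simp: Da_def add.commute)
    then have rest: "qX (\<Sum>n\<in>D0. scaleX (d n) (x n)) \<le> L"
      unfolding L_def using X.q_add_le_bounds[OF rest_a rest_b] by simp
    have "(\<Sum>n\<in>D0. scaleX (if n \<in> A then a n else 0) (x n)) = (\<Sum>n\<in>A. scaleX (a n) (x n))"
      by (rule sum.mono_neutral_cong_right) (use D0 AD in auto)
    moreover have "scaleX (pair_coeff D a b n) (x n) = scaleX (if n \<in> A then a n else 0) (x n) + scaleX (d n) (x n)" for n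
      by (simp add: d_def flip: X.scale_left_distrib)
    ultimately have "(\<Sum>n\<in>D0. scaleX (pair_coeff D a b n) (x n)) =
        coord_proj scaleX qX x A f + (\<Sum>n\<in>D0. scaleX (d n) (x n))"
      by (simp add: sum.distrib coord_proj_def a)
    also have "qX \<dots> \<le> X.kappa * (qX (coord_proj scaleX qX x A f) + L)" (is "_ \<le> X.kappa * (?q + L)")
      by (rule X.q_add_le_bounds[OF order_refl rest])
    also have "\<dots> \<le> X.kappa * ((1 + L) * (1 + ?q))"
      using X.kappa_ge_1 L X.q_nonneg[of "coord_proj scaleX qX x A f"]
      by (intro mult_left_mono) (auto simp: algebra_simps)
    finally show "\<exists>A. greedy_set scaleX qX x f A \<and> card A \<le> card D \<and>
            qX (\<Sum>n\<in>(\<lambda>i. i div 2) ` D. scaleX (pair_coeff D a b n) (x n))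
              \<le> X.kappa * (1 + L) * (1 + qX (coord_proj scaleX qX x A f))"
      using A_greedy A(2) by (intro exI[of _ A]) (auto simp: mult.assoc D0_def)
  qed
qed

section \<open>The direct sum and its diamond basis\<close>

lemma sum_scale_Pair [simp]: "sum_scale scaleX scaleY c (f, g) = (scaleX c f, scaleY c g)"
  by (simp add: sum_scale_def)

lemma sum_qnorm_Pair [simp]: "sum_qnorm qX qY (f, g) = max (qX f) (qY g)"
  by (simp add: sum_qnorm_def)

lemma quasi_banach_sum:
  assumes "quasi_banach scaleX qX" and "quasi_banach scaleY qY"
  shows "quasi_banach (sum_scale scaleX scaleY) (sum_qnorm qX qY)"
proof -
  interpret X: quasi_banach scaleX qX by fact
  interpret Y: quasi_banach scaleY qY by fact
  show ?thesis
  proof unfold_locales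
    fix a b :: 'a and u v
    show "sum_scale scaleX scaleY a (u + v) = sum_scale scaleX scaleY a u + sum_scale scaleX scaleY a v"
      by (cases u; cases v) (simp add: X.scale_right_distrib Y.scale_right_distrib)
    show "sum_scale scaleX scaleY (a + b) u = sum_scale scaleX scaleY a u + sum_scale scaleX scaleY b u"
      by (cases u) (simp add: X.scale_left_distrib Y.scale_left_distrib)
    show "sum_scale scaleX scaleY a (sum_scale scaleX scaleY b u) = sum_scale scaleX scaleY (a * b) u"
      by (cases u) simp
    show "sum_scale scaleX scaleY 1 u = u" by (cases u) simp
    show "0 \<le> sum_qnorm qX qY u" by (cases u) (simp add: X.q_nonneg le_max_iff_disj)
    show "sum_qnorm qX qY u = 0 \<longleftrightarrow> u = 0"
      using X.q_nonneg[of "fst u"] Y.q_nonneg[of "snd u"] X.q_eq_0_iff[of "fst u"] Y.q_eq_0_iff[of "snd u"]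
      by (cases u) (auto simp: max_def zero_prod_def)
    show "sum_qnorm qX qY (sum_scale scaleX scaleY a u) = norm a * sum_qnorm qX qY u"
      by (cases u) (simp add: X.q_scale Y.q_scale max_mult_distrib_left)
  next
    let ?K = "max X.kappa Y.kappa"
    show "\<exists>\<kappa>\<ge>1. \<forall>f g. sum_qnorm qX qY (f + g) \<le> \<kappa> * (sum_qnorm qX qY f + sum_qnorm qX qY g)"
    proof (intro exI[of _ ?K] conjI allI)
      show "1 \<le> ?K" using X.kappa_ge_1 by simp
      fix u v :: "'b \<times> 'c"
      obtain f g f' g' where uv: "u = (f, g)" "v = (f', g')" by (cases u; cases v)
      let ?S = "max (qX f) (qY g) + max (qX f') (qY g')"
      have "0 \<le> ?S" using X.q_nonneg[of f] X.q_nonneg[of f'] by simp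
      have "qX (f + f') \<le> X.kappa * ?S" by (rule X.q_add_le_bounds) auto
      also have "\<dots> \<le> ?K * ?S" using \<open>0 \<le> ?S\<close> by (intro mult_right_mono) auto
      finally have 1: "qX (f + f') \<le> ?K * ?S" .
      have "qY (g + g') \<le> Y.kappa * ?S" by (rule Y.q_add_le_bounds) auto
      also have "\<dots> \<le> ?K * ?S" using \<open>0 \<le> ?S\<close> by (intro mult_right_mono) auto
      finally show "sum_qnorm qX qY (u + v) \<le> ?K * (sum_qnorm qX qY u + sum_qnorm qX qY v)"
        using 1 by (simp add: uv)
    qed
  next
    fix u :: "nat \<Rightarrow> 'b \<times> 'c"
    assume Cauchy: "\<forall>e>0. \<exists>N. \<forall>m\<ge>N. \<forall>n\<ge>N. sum_qnorm qX qY (u m - u n) < e"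
    have max: "sum_qnorm qX qY v = max (qX (fst v)) (qY (snd v))" for v by (cases v) simp
    have "\<exists>l. (\<lambda>n. qX (fst (u n) - l)) \<longlonglongrightarrow> 0"
      by (rule X.q_complete) (use Cauchy in \<open>simp add: max; meson\<close>)
    then obtain l where l: "(\<lambda>n. qX (fst (u n) - l)) \<longlonglongrightarrow> 0" by blast
    have "\<exists>l. (\<lambda>n. qY (snd (u n) - l)) \<longlonglongrightarrow> 0"
      by (rule Y.q_complete) (use Cauchy in \<open>simp add: max; meson\<close>)
    then obtain l' where l': "(\<lambda>n. qY (snd (u n) - l')) \<longlonglongrightarrow> 0" by blast
    have "(\<lambda>n. max (qX (fst (u n) - l)) (qY (snd (u n) - l'))) \<longlonglongrightarrow> max 0 0"
      using l l' by (rule tendsto_max)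
    then show "\<exists>l. (\<lambda>n. sum_qnorm qX qY (u n - l)) \<longlonglongrightarrow> 0"
      by (intro exI[of _ "(l, l')"]) (simp add: max)
  qed
qed

lemma of_real_inverse_sqrt_2_mult:
  "of_real (1 / sqrt 2) * (of_real (1 / sqrt 2) * c) = c / (2 :: 'a::real_field)"
  "of_real (1 / sqrt 2) * of_real (1 / sqrt 2) = (1 / 2 :: 'a::real_field)"
proof -
  have "of_real (1 / sqrt 2) * of_real (1 / sqrt 2) = (of_real (1 / 2) :: 'a)"
    unfolding of_real_mult[symmetric] by (simp del: of_real_divide)
  then show "of_real (1 / sqrt 2) * of_real (1 / sqrt 2) = (1 / 2 :: 'a::real_field)" by simp
  then show "of_real (1 / sqrt 2) * (of_real (1 / sqrt 2) * c) = c / (2 :: 'a::real_field)"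
    unfolding mult.assoc[symmetric] by simp
qed

text \<open>Both claims are proved together: the explicit functionals \<open>zs\<close> form a dual
  sequence, and uniqueness, which identifies them as the dual basis, requires that the diamond is a
  basis.\<close>

lemma diamond_basis:
  fixes scaleX :: "'k::real_or_complex \<Rightarrow> 'v::ab_group_add \<Rightarrow> 'v"
    and scaleY :: "'k \<Rightarrow> 'w::ab_group_add \<Rightarrow> 'w"
  assumes X: "is_basis scaleX qX x" and Y: "is_basis scaleY qY y"
  shows is_basis_diamond: "is_basis (sum_scale scaleX scaleY) (sum_qnorm qX qY) (diamond scaleX scaleY x y)"
    and dual_basis_diamond:
      "dual_basis (sum_scale scaleX scaleY) (sum_qnorm qX qY) (diamond scaleX scaleY x y) i (f, g) =
         of_real (1 / sqrt 2) *
           alt_coeffs (\<lambda>n. dual_basis scaleX qX x n f) (\<lambda>n. dual_basis scaleY qY y n g) i"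
proof -
  interpret X: quasi_banach scaleX qX using X by (simp add: is_basis_def)
  interpret Y: quasi_banach scaleY qY using Y by (simp add: is_basis_def)
  let ?s = "sum_scale scaleX scaleY" and ?q = "sum_qnorm qX qY" and ?z = "diamond scaleX scaleY x y"
  define r where "r = (of_real (1 / sqrt 2) :: 'k)"
  have rr: "r * r = 1 / 2" unfolding r_def by (rule of_real_inverse_sqrt_2_mult)
  \<comment> \<open>Biorthogonality and the recovery of \<open>x n\<close> and \<open>y n\<close>
    from their pair both rest on \<open>2 * r * r = 1\<close>.\<close>
  have "r * 2 * r = 2 * (r * r)" by (simp only: mult_ac)
  then have r2r: "r * 2 * r = 1" "r * (2 * r) = 1" by (simp_all add: rr mult.assoc)
  have norm_r: "norm r \<le> 1" by (simp add: r_def norm_divide)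
  interpret Z: quasi_banach ?s ?q by (rule quasi_banach_sum; unfold_locales)
  define xs where "xs = dual_basis scaleX qX x"
  define ys where "ys = dual_basis scaleY qY y"
  have dX: "is_dual_sequence scaleX qX x xs" unfolding xs_def
      by (rule X.is_dual_sequence_dual_basis[OF X])
  have dY: "is_dual_sequence scaleY qY y ys" unfolding ys_def
      by (rule Y.is_dual_sequence_dual_basis[OF Y])
  have linX: "Vector_Spaces.linear scaleX (*) (xs n)" for n using dX by (simp add: is_dual_sequence_def)
  have linY: "Vector_Spaces.linear scaleY (*) (ys n)" for n using dY by (simp add: is_dual_sequence_def)
  define zs where "zs i = (\<lambda>(f, g). r * alt_coeffs (\<lambda>n. xs n f) (\<lambda>n. ys n g) i)" for i
  have z: "?z i = (scaleX r (x (i div 2)), scaleY r (if even i then y (i div 2) else - y (i div 2)))" for i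
    by (simp add: diamond_def r_def)
  have dZ: "is_dual_sequence ?s ?q ?z zs"
    unfolding is_dual_sequence_def
  proof (intro conjI allI)
    fix i
    interpret xs: Vector_Spaces.linear scaleX "(*)" "xs (i div 2)" by (rule linX)
    interpret ys: Vector_Spaces.linear scaleY "(*)" "ys (i div 2)" by (rule linY)
    show "Vector_Spaces.linear ?s (*) (zs i)"
    proof (unfold_locales, goal_cases)
      case (1 u v)
      show ?case by (cases u; cases v) (simp add: zs_def alt_coeffs_def xs.add ys.add algebra_simps)
    next
      case (2 c u)
      obtain f g where u: "u = (f, g)" by (cases u)
      have "alt_coeffs (\<lambda>n. xs n (scaleX c f)) (\<lambda>n. ys n (scaleY c g)) i =
          c * alt_coeffs (\<lambda>n. xs n f) (\<lambda>n. ys n g) i"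
        by (simp add: alt_coeffs_def xs.scale ys.scale distrib_left right_diff_distrib)
      then show ?case by (simp add: u zs_def mult.left_commute)
    qed
    fix k
    have xk: "xs m (x n) = (if m = n then 1 else 0)"
        and yk: "ys m (y n) = (if m = n then 1 else 0)" for m n
      using dX dY by (simp_all add: is_dual_sequence_def)
    have "xs m (scaleX c f) = c * xs m f" for m c f
      using linX[of m] by (simp add: Vector_Spaces.linear_iff)
    moreover have scaleY: "ys m (scaleY c g) = c * ys m g" for m c g
      using linY[of m] by (simp add: Vector_Spaces.linear_iff)
    moreover have "ys m (- g) = - ys m g" for m g
      using scaleY[of m "-1" g] by simp
    moreover have "i = k" if "i div 2 = k div 2" "even i = even k" using that by presburger
    \<comment> \<open>Within one pair, the contributions of the two components cancel for opposite
      parity and add up to \<open>2 * r * r\<close> for equal parity.\<close>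
    ultimately show "zs i (?z k) = (if i = k then 1 else 0)"
      by (auto simp: zs_def z alt_coeffs_def xk yk r2r distrib_left)
  next
    obtain C where C: "C \<ge> 0" "\<And>n f. norm (xs n f) \<le> C * qX f"
        using X.dual_sequence_bounded[OF dX] by blast
    obtain C' where C': "C' \<ge> 0" "\<And>n g. norm (ys n g) \<le> C' * qY g"
        using Y.dual_sequence_bounded[OF dY] by blast
    show "\<exists>C. \<forall>i. dual_norm ?q (zs i) \<le> ennreal C"
    proof (intro exI allI)
      fix i
      show "dual_norm ?q (zs i) \<le> ennreal (C + C')"
        unfolding dual_norm_def
      proof (rule SUP_least, clarify)
        fix f g assume "?q (f, g) \<le> 1"
        then have fg: "qX f \<le> 1" "qY g \<le> 1" by auto
        have bounds: "norm (xs n f) \<le> C" "norm (ys n g) \<le> C'" for n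
          using C(2)[of n f] C'(2)[of n g] mult_left_mono[OF fg(1) C(1)] mult_left_mono[OF fg(2) C'(1)] by simp_all
        have "norm (alt_coeffs (\<lambda>n. xs n f) (\<lambda>n. ys n g) i)
            \<le> norm (xs (i div 2) f) + norm (ys (i div 2) g)"
          by (simp add: alt_coeffs_def norm_triangle_ineq norm_triangle_ineq4)
        also have "\<dots> \<le> C + C'" by (intro add_mono bounds)
        finally have "norm (alt_coeffs (\<lambda>n. xs n f) (\<lambda>n. ys n g) i) \<le> C + C'" .
        then have "norm r * norm (alt_coeffs (\<lambda>n. xs n f) (\<lambda>n. ys n g) i) \<le> 1 * (C + C')"
          using norm_r by (intro mult_mono) auto
        then show "ennreal (norm (zs i (f, g))) \<le> ennreal (C + C')"
          by (intro ennreal_leI) (simp add: zs_def norm_mult)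
      qed
    qed
  qed
  have spanX: "(f, 0) \<in> Z.span (range ?z)" if "f \<in> X.span (range x)" for f
    using that
  proof (induction rule: X.span_induct_alt)
    case base
    show ?case using Z.span_zero by (simp add: zero_prod_def)
  next
    case (step c u v)
    then obtain n where u: "u = x n" by blast
    \<comment> \<open>The two vectors of a pair have equal first and opposite second components, so
      their sum isolates \<open>x n\<close>; likewise their difference will isolate
      \<open>y n\<close>.\<close>
    have "?s r (?z (2 * n) + ?z (Suc (2 * n))) \<in> Z.span (range ?z)"
      by (intro Z.span_scale Z.span_add Z.span_base) auto
    also have "?s r (?z (2 * n) + ?z (Suc (2 * n))) = (u, 0)"
      by (simp add: z u r2r X.scale_right_distrib flip: X.scale_left_distrib)
    finally have "?s c (u, 0) + (v, 0) \<in> Z.span (range ?z)"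
      using step.IH by (intro Z.span_add Z.span_scale)
    then show ?case by simp
  qed
  have spanY: "(0, g) \<in> Z.span (range ?z)" if "g \<in> Y.span (range y)" for g
    using that
  proof (induction rule: Y.span_induct_alt)
    case base
    show ?case using Z.span_zero by (simp add: zero_prod_def)
  next
    case (step c u v)
    then obtain n where u: "u = y n" by blast
    have "?s r (?z (2 * n) - ?z (Suc (2 * n))) \<in> Z.span (range ?z)"
      by (intro Z.span_scale Z.span_diff Z.span_base) auto
    also have "?s r (?z (2 * n) - ?z (Suc (2 * n))) = (0, u)"
      by (simp add: z u r2r Y.scale_right_distrib flip: Y.scale_left_distrib)
    finally have "?s c (0, u) + (0, v) \<in> Z.span (range ?z)"
      using step.IH by (intro Z.span_add Z.span_scale)
    then show ?case by simp
  qed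
  show Z: "is_basis ?s ?q ?z"
    unfolding is_basis_def
  proof (intro conjI allI impI)
    show "quasi_banach ?s ?q" by unfold_locales
    obtain C where C: "\<And>n. qX (x n) \<le> C" using X unfolding is_basis_def by blast
    obtain C' where C': "\<And>n. qY (y n) \<le> C'" using Y unfolding is_basis_def by blast
    show "\<exists>C. \<forall>i. ?q (?z i) \<le> C"
    proof (intro exI allI)
      fix i
      have "?q (?z i) = norm r * max (qX (x (i div 2))) (qY (y (i div 2)))"
        by (simp add: z X.q_scale Y.q_scale max_mult_distrib_left)
      also have "\<dots> \<le> norm r * max C C'" by (intro mult_left_mono max.mono C C') simp
      finally show "?q (?z i) \<le> norm r * max C C'" .
    qed
  next
    fix u :: "'v \<times> 'w" and e :: real assume e: "0 < e"
    obtain f g where u: "u = (f, g)" by (cases u)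
    obtain f' where f': "f' \<in> X.span (range x)" "qX (f - f') < e"
        using X e unfolding is_basis_def by blast
    obtain g' where g': "g' \<in> Y.span (range y)" "qY (g - g') < e"
        using Y e unfolding is_basis_def by blast
    have "(f', 0) + (0, g') \<in> Z.span (range ?z)" by (intro Z.span_add spanX spanY f' g')
    moreover have "?q (u - (f', g')) < e" using f' g' by (simp add: u)
    ultimately show "\<exists>g\<in>Z.span (range ?z). ?q (u - g) < e" by auto
  qed (use dZ in blast)
  show "dual_basis ?s ?q ?z i (f, g) =
      of_real (1 / sqrt 2) * alt_coeffs (\<lambda>n. dual_basis scaleX qX x n f) (\<lambda>n. dual_basis scaleY qY y n g) i"
    unfolding Z.dual_basis_eq[OF Z dZ] by (simp add: zs_def xs_def ys_def r_def)
qed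

section \<open>Projections and greedy sets of the diamond\<close>

text \<open>The factors \<open>1 / sqrt 2\<close> of functional and vector combine to the division
  by 2 in \<open>pair_coeff\<close>. In the second component the sign of \<open>y n\<close> at odd
  indices turns \<open>a n - b n\<close> into \<open>b n - a n\<close>, which exchanges
  \<open>a\<close> and \<open>b\<close>.\<close>

lemma coord_proj_diamond:
  fixes scaleX :: "'k::real_or_complex \<Rightarrow> 'v::ab_group_add \<Rightarrow> 'v"
    and scaleY :: "'k \<Rightarrow> 'w::ab_group_add \<Rightarrow> 'w"
  assumes X: "is_basis scaleX qX x" and Y: "is_basis scaleY qY y" and D: "finite D"
    and a: "a = (\<lambda>n. dual_basis scaleX qX x n f)" and b: "b = (\<lambda>n. dual_basis scaleY qY y n g)"
  shows "coord_proj (sum_scale scaleX scaleY) (sum_qnorm qX qY) (diamond scaleX scaleY x y) D (f, g) =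
     (\<Sum>n\<in>(\<lambda>i. i div 2) ` D. scaleX (pair_coeff D a b n) (x n),
      \<Sum>n\<in>(\<lambda>i. i div 2) ` D. scaleY (pair_coeff D b a n) (y n))"
proof -
  interpret X: quasi_banach scaleX qX using X by (simp add: is_basis_def)
  interpret Y: quasi_banach scaleY qY using Y by (simp add: is_basis_def)
  let ?w = "alt_coeffs a b"
  have "coord_proj (sum_scale scaleX scaleY) (sum_qnorm qX qY) (diamond scaleX scaleY x y) D (f, g) =
    (\<Sum>i\<in>D. (scaleX (?w i / 2) (x (i div 2)),
             scaleY (?w i / 2) (if even i then y (i div 2) else - y (i div 2))))"
    unfolding coord_proj_def dual_basis_diamond[OF X Y] diamond_def sum_scale_Pair X.scale_scale Y.scale_scale
      a[symmetric] b[symmetric] mult.assoc mult.left_commute[of _ "of_real (1 / sqrt 2)"]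
    by (simp only: mult.commute[of "?w _"] of_real_inverse_sqrt_2_mult)
  also have "\<dots> = (\<Sum>i\<in>D. scaleX (?w i / 2) (x (i div 2)),
             \<Sum>i\<in>D. scaleY (?w i / 2) (if even i then y (i div 2) else - y (i div 2)))"
    by (rule prod_eqI) (simp_all add: fst_sum snd_sum)
  also have "(\<Sum>i\<in>D. scaleX (?w i / 2) (x (i div 2))) =
      (\<Sum>n\<in>(\<lambda>i. i div 2) ` D. scaleX (pair_coeff D a b n) (x n))"
    by (subst sum_over_pairs[OF D], rule sum.cong)
      (auto simp: pair_coeff_def X.scale_left_distrib add_divide_distrib)
  also have "(\<Sum>i\<in>D. scaleY (?w i / 2) (if even i then y (i div 2) else - y (i div 2))) =
      (\<Sum>n\<in>(\<lambda>i. i div 2) ` D. scaleY (pair_coeff D b a n) (y n))"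
    by (subst sum_over_pairs[OF D], rule sum.cong)
      (auto simp: pair_coeff_def Y.scale_left_distrib Y.scale_left_diff_distrib add_divide_distrib diff_divide_distrib)
  finally show ?thesis .
qed

lemma greedy_set_diamond_iff:
  assumes "is_basis scaleX qX x" and "is_basis scaleY qY y"
    and "a = (\<lambda>n. dual_basis scaleX qX x n f)" and "b = (\<lambda>n. dual_basis scaleY qY y n g)"
  shows "greedy_set (sum_scale scaleX scaleY) (sum_qnorm qX qY) (diamond scaleX scaleY x y) (f, g) D \<longleftrightarrow>
    finite D \<and> (\<forall>i\<in>D. \<forall>k. k \<notin> D \<longrightarrow> norm (alt_coeffs a b k) \<le> norm (alt_coeffs a b i))"
  unfolding greedy_set_def dual_basis_diamond[OF assms(1,2)] assms(3,4)
  by (simp add: norm_mult norm_divide divide_le_cancel)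

lemma finite_pairs: "finite A \<Longrightarrow> finite {i::nat. i div 2 \<in> A}"
  and card_pairs_le: "finite A \<Longrightarrow> card {i::nat. i div 2 \<in> A} \<le> 2 * card A"
proof -
  assume A: "finite A"
  have eq: "{i. i div 2 \<in> A} = (\<lambda>n. 2 * n) ` A \<union> (\<lambda>n. Suc (2 * n)) ` A" (is "_ = ?E \<union> ?O")
  proof (intro set_eqI iffI)
    fix i assume i: "i \<in> {i. i div 2 \<in> A}"
    have "i = 2 * (i div 2) \<or> i = Suc (2 * (i div 2))" by presburger
    then show "i \<in> ?E \<union> ?O" using i by blast
  qed auto
  show "finite {i::nat. i div 2 \<in> A}" unfolding eq using A by simp
  have "card (?E \<union> ?O) \<le> card A + card A"
    by (rule order_trans[OF card_Un_le add_mono]; rule card_image_le[OF A])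
  then show "card {i. i div 2 \<in> A} \<le> 2 * card A" unfolding eq by simp
qed

lemma image_pairs: "(\<lambda>i. i div 2) ` {i::nat. i div 2 \<in> A} = A"
proof
  show "A \<subseteq> (\<lambda>i. i div 2) ` {i. i div 2 \<in> A}"
  proof
    fix n assume "n \<in> A"
    then show "n \<in> (\<lambda>i. i div 2) ` {i. i div 2 \<in> A}" by (intro image_eqI[of _ _ "2 * n"]) simp_all
  qed
qed auto

lemma dual_basis_0:
  assumes "is_basis scale q x"
  shows "dual_basis scale q x n 0 = 0"
proof -
  interpret quasi_banach scale q using assms by (simp add: is_basis_def)
  interpret Vector_Spaces.linear scale "(*)" "dual_basis scale q x n"
    using is_dual_sequence_dual_basis[OF assms] by (simp add: is_dual_sequence_def)
  show ?thesis by (rule zero)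
qed

lemma pair_coeff_pairs:
  assumes "n \<in> A"
  shows "pair_coeff {i. i div 2 \<in> A} a b n = a n"
  using assms by (simp add: pair_coeff_def)

text \<open>For \<open>(f, 0)\<close> both indices of a pair carry coefficients of equal absolute
  value, so all pairs over a greedy set form a greedy set whose projection has first component
  \<open>coord_proj scaleX qX x A f\<close>. The same holds for \<open>(0, g)\<close> and the second
  component. Doubling the set accounts for \<open>2 * card A \<le> m\<close>.\<close>

lemma le_g_param_diamond:
  fixes scaleX :: "'k::real_or_complex \<Rightarrow> 'v::ab_group_add \<Rightarrow> 'v"
    and scaleY :: "'k \<Rightarrow> 'w::ab_group_add \<Rightarrow> 'w"
  assumes X: "is_basis scaleX qX x" and Y: "is_basis scaleY qY y"
  defines "gZ \<equiv> g_param (sum_scale scaleX scaleY) (sum_qnorm qX qY) (diamond scaleX scaleY x y)"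
  shows le_g_param_diamond_left: "greedy_set scaleX qX x f A \<Longrightarrow> qX f \<le> 1 \<Longrightarrow> 2 * card A \<le> m \<Longrightarrow>
           ennreal (qX (coord_proj scaleX qX x A f)) \<le> gZ m"
    and le_g_param_diamond_right: "greedy_set scaleY qY y g B \<Longrightarrow> qY g \<le> 1 \<Longrightarrow> 2 * card B \<le> m \<Longrightarrow>
           ennreal (qY (coord_proj scaleY qY y B g)) \<le> gZ m"
proof -
  interpret X: quasi_banach scaleX qX using X by (simp add: is_basis_def)
  interpret Y: quasi_banach scaleY qY using Y by (simp add: is_basis_def)
  let ?s = "sum_scale scaleX scaleY" and ?q = "sum_qnorm qX qY" and ?z = "diamond scaleX scaleY x y"
  interpret Z: quasi_banach ?s ?q by (rule quasi_banach_sum; unfold_locales)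
  {
    assume A: "greedy_set scaleX qX x f A" and f: "qX f \<le> 1" and m: "2 * card A \<le> m"
    let ?E = "{i. i div 2 \<in> A}" and ?a = "\<lambda>n. dual_basis scaleX qX x n f"
    have fin: "finite A" using A by (simp add: greedy_set_def)
    have "greedy_set ?s ?q ?z (f, 0) ?E"
      unfolding greedy_set_diamond_iff[OF X Y refl refl]
      using A finite_pairs[OF fin] by (auto simp: greedy_set_def alt_coeffs_def dual_basis_0[OF Y])
    then have "ennreal (?q (coord_proj ?s ?q ?z ?E (f, 0))) \<le> gZ m"
      unfolding gZ_def using f card_pairs_le[OF fin] m by (intro Z.le_g_param) auto
    moreover have "qX (coord_proj scaleX qX x A f) \<le> ?q (coord_proj ?s ?q ?z ?E (f, 0))"
      unfolding coord_proj_diamond[OF X Y finite_pairs[OF fin] refl refl] image_pairs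
      by (simp add: pair_coeff_pairs coord_proj_def)
    ultimately show "ennreal (qX (coord_proj scaleX qX x A f)) \<le> gZ m"
      using ennreal_leI order_trans by blast
  next
    assume B: "greedy_set scaleY qY y g B" and g: "qY g \<le> 1" and m: "2 * card B \<le> m"
    let ?E = "{i. i div 2 \<in> B}" and ?b = "\<lambda>n. dual_basis scaleY qY y n g"
    have fin: "finite B" using B by (simp add: greedy_set_def)
    have "greedy_set ?s ?q ?z (0, g) ?E"
      unfolding greedy_set_diamond_iff[OF X Y refl refl]
      using B finite_pairs[OF fin] by (auto simp: greedy_set_def alt_coeffs_def dual_basis_0[OF X])
    then have "ennreal (?q (coord_proj ?s ?q ?z ?E (0, g))) \<le> gZ m"
      unfolding gZ_def using g card_pairs_le[OF fin] m by (intro Z.le_g_param) auto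
    moreover have "qY (coord_proj scaleY qY y B g) \<le> ?q (coord_proj ?s ?q ?z ?E (0, g))"
      unfolding coord_proj_diamond[OF X Y finite_pairs[OF fin] refl refl] image_pairs
      by (simp add: pair_coeff_pairs coord_proj_def)
    ultimately show "ennreal (qY (coord_proj scaleY qY y B g)) \<le> gZ m"
      using ennreal_leI order_trans by blast
  }
qed

section \<open>Comparison of the parameters up to constants\<close>

text \<open>As \<open>G\<close> is at least 1, it also absorbs the summand 1, at the cost of a
  factor 2.\<close>

lemma ennreal_affine_le:
  assumes "r \<le> C * (1 + s)" and "0 \<le> C" and "0 \<le> s" and "ennreal s \<le> G" and "1 \<le> G"
  shows "ennreal r \<le> ennreal (2 * C) * G"
proof -
  have "ennreal r \<le> ennreal (C * (1 + s))" using assms(1) by (rule ennreal_leI)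
  also have "\<dots> = ennreal C * (1 + ennreal s)" using assms by (simp add: ennreal_mult)
  also have "\<dots> \<le> ennreal C * (G + G)" using assms by (intro mult_left_mono add_mono) auto
  also have "\<dots> = ennreal (2 * C) * G" using assms(2) by (simp add: ennreal_mult mult_2[symmetric] mult_ac)
  finally show ?thesis .
qed

text \<open>A single halving suffices: the hypothesis on greedy sets of at most half the size is
  exactly what \<open>le_g_param_diamond\<close> provides.\<close>

lemma (in quasi_banach) g_param_le_of_halved:
  assumes "bidemocratic_basis scale q x"
  obtains C where "0 \<le> C"
    and "\<And>m G. 0 < m \<Longrightarrow> 1 \<le> G \<Longrightarrow>
           (\<And>A f. greedy_set scale q x f A \<Longrightarrow> q f \<le> 1 \<Longrightarrow> 2 * card A \<le> m \<Longrightarrow>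
           ennreal (q (coord_proj scale q x A f)) \<le> G) \<Longrightarrow>
           g_param scale q x m \<le> ennreal C * G"
proof -
  obtain C where C0: "C \<ge> 0" and C: "\<And>A f. greedy_set scale q x f A \<Longrightarrow> q f \<le> 1 \<Longrightarrow>
           (\<exists>A1. greedy_set scale q x f A1 \<and> 2 * card A1 \<le> card A \<and>
                 q (coord_proj scale q x A f) \<le> C * (1 + q (coord_proj scale q x A1 f)))"
    by (rule greedy_set_halving[OF assms]) blast
  show thesis
  proof (rule that[of "2 * C"])
    show "0 \<le> 2 * C" using C0 by simp
    fix m :: nat and G :: ennreal
    assume G: "1 \<le> G" and halved: "\<And>A f. greedy_set scale q x f A \<Longrightarrow> q f \<le> 1 \<Longrightarrow> 2 * card A \<le> m \<Longrightarrow>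
        ennreal (q (coord_proj scale q x A f)) \<le> G"
    show "g_param scale q x m \<le> ennreal (2 * C) * G"
    proof (rule g_param_le)
      fix A f assume A: "greedy_set scale q x f A" "q f \<le> 1" "card A \<le> m"
      obtain A1 where A1: "greedy_set scale q x f A1" "2 * card A1 \<le> card A"
        "q (coord_proj scale q x A f) \<le> C * (1 + q (coord_proj scale q x A1 f))"
        using C[OF A(1,2)] by blast
      show "ennreal (q (coord_proj scale q x A f)) \<le> ennreal (2 * C) * G"
        by (rule ennreal_affine_le[OF A1(3) C0 q_nonneg halved[OF A1(1) A(2)] G]) (use A1 A in simp)
    qed
  qed
qed

text \<open>Inverting the positive lower constant gives a domination in each direction, one for each
  component estimate.\<close>

lemma approx_equiv_sym_le:
  assumes "approx_equiv \<alpha> \<beta>"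
  obtains C C' where "\<And>m. \<alpha> m \<le> ennreal C * \<beta> m" and "\<And>m. \<beta> m \<le> ennreal C' * \<alpha> m"
proof -
  obtain c C where c: "0 < c" and le: "\<And>m. ennreal c * \<beta> m \<le> \<alpha> m" "\<And>m. \<alpha> m \<le> ennreal C * \<beta> m"
    using assms unfolding approx_equiv_def by blast
  have "\<beta> m \<le> ennreal (1 / c) * \<alpha> m" for m
  proof -
    have "\<beta> m = ennreal (1 / c) * (ennreal c * \<beta> m)"
      using c by (simp add: mult.assoc[symmetric] ennreal_mult[symmetric])
    also have "\<dots> \<le> ennreal (1 / c) * \<alpha> m" by (intro mult_left_mono le) simp
    finally show ?thesis .
  qed
  with le(2) show thesis by (rule that)
qed

text \<open>Enlarging both constants to at least 1 makes the lower one positive and gives the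
  required order \<open>1 / ?C' \<le> 1 \<le> ?C\<close>.\<close>

lemma approx_equivI:
  assumes "\<And>m. \<alpha> m \<le> ennreal C * \<beta> m" and "\<And>m. \<beta> m \<le> ennreal C' * \<alpha> m"
  shows "approx_equiv \<alpha> \<beta>"
  unfolding approx_equiv_def
proof (intro exI conjI allI)
  let ?C = "max C 1" and ?C' = "max C' 1"
  show "0 < 1 / ?C'" by simp
  have "1 / ?C' \<le> 1" by simp
  then show "1 / ?C' \<le> ?C" by linarith
  fix m
  have "ennreal (1 / ?C') * \<beta> m \<le> ennreal (1 / ?C') * (ennreal ?C' * \<alpha> m)"
    by (intro mult_left_mono order_trans[OF assms(2)] mult_right_mono ennreal_leI) auto
  also have "\<dots> = ennreal (1 / ?C' * ?C') * \<alpha> m"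
    by (simp add: mult.assoc[symmetric] ennreal_mult[symmetric])
  also have "1 / ?C' * ?C' = 1" by (simp add: max_def)
  finally show "ennreal (1 / ?C') * \<beta> m \<le> \<alpha> m" by simp
  show "\<alpha> m \<le> ennreal ?C * \<beta> m"
    by (intro order_trans[OF assms(1)] mult_right_mono ennreal_leI) auto
qed

lemma SUP_ennreal_dominated_finite:
  assumes "\<And>m. \<alpha> m \<le> ennreal C * \<beta> m" and "(SUP m. \<beta> m) < \<infinity>"
  shows "(SUP m. \<alpha> m) < \<infinity>"
proof -
  have "(SUP m. \<alpha> m) \<le> ennreal C * (SUP m. \<beta> m)"
    by (intro SUP_least order_trans[OF assms(1)] mult_left_mono SUP_upper) auto
  also have "\<dots> < \<infinity>" using assms(2) by (simp add: ennreal_mult_less_top)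
  finally show ?thesis .
qed

theorem theorem4p6:
  fixes scaleX :: "'k::real_or_complex \<Rightarrow> 'v::ab_group_add \<Rightarrow> 'v"
    and scaleY :: "'k \<Rightarrow> 'w::ab_group_add \<Rightarrow> 'w"
    and qX :: "'v \<Rightarrow> real" and qY :: "'w \<Rightarrow> real"
    and x :: "nat \<Rightarrow> 'v" and y :: "nat \<Rightarrow> 'w"
  assumes "quasi_banach scaleX qX" and "quasi_banach scaleY qY"
    and "bidemocratic_basis scaleX qX x" and "bidemocratic_basis scaleY qY y"
    and "approx_equiv (phi_u scaleX qX x) (phi_u scaleY qY y)"
  shows "approx_equiv
           (g_param (sum_scale scaleX scaleY) (sum_qnorm qX qY) (diamond scaleX scaleY x y))
           (\<lambda>m. max (g_param scaleX qX x m) (g_param scaleY qY y m)) \<and>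
         (quasi_greedy_basis (sum_scale scaleX scaleY) (sum_qnorm qX qY)
            (diamond scaleX scaleY x y) \<longleftrightarrow>
          quasi_greedy_basis scaleX qX x \<and> quasi_greedy_basis scaleY qY y)"
proof -
  interpret X: quasi_banach scaleX qX by fact
  interpret Y: quasi_banach scaleY qY by fact
  let ?s = "sum_scale scaleX scaleY" and ?q = "sum_qnorm qX qY" and ?z = "diamond scaleX scaleY x y"
  interpret Z: quasi_banach ?s ?q by (rule quasi_banach_sum; unfold_locales)
  have X: "is_basis scaleX qX x" and Y: "is_basis scaleY qY y"
    using assms(3,4) by (simp_all add: bidemocratic_basis_def)
  have Z: "is_basis ?s ?q ?z" by (rule is_basis_diamond[OF X Y])
  let ?gX = "g_param scaleX qX x" and ?gY = "g_param scaleY qY y" and ?gZ = "g_param ?s ?q ?z"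
  let ?g = "\<lambda>m. max (?gX m) (?gY m)"
  obtain C1 C2 where XY: "\<And>m. phi_u scaleX qX x m \<le> ennreal C1 * phi_u scaleY qY y m"
    and YX: "\<And>m. phi_u scaleY qY y m \<le> ennreal C2 * phi_u scaleX qX x m"
    by (rule approx_equiv_sym_le[OF assms(5)]) blast

  obtain CX where CX0: "0 \<le> CX"
    and CX: "\<And>D f g a b. finite D \<Longrightarrow> D \<noteq> {} \<Longrightarrow> qX f \<le> 1 \<Longrightarrow> qY g \<le> 1 \<Longrightarrow>
          a = (\<lambda>n. dual_basis scaleX qX x n f) \<Longrightarrow> b = (\<lambda>n. dual_basis scaleY qY y n g) \<Longrightarrow>
          (\<And>i k. i \<in> D \<Longrightarrow> k \<notin> D \<Longrightarrow> norm (alt_coeffs a b k) \<le> norm (alt_coeffs a b i)) \<Longrightarrow>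
          \<exists>A. greedy_set scaleX qX x f A \<and> card A \<le> card D \<and>
            qX (\<Sum>n\<in>(\<lambda>i. i div 2) ` D. scaleX (pair_coeff D a b n) (x n))
              \<le> CX * (1 + qX (coord_proj scaleX qX x A f))"
    by (rule diamond_greedy_component_le[OF assms(1-4) XY]) blast
  \<comment> \<open>The same estimate with the spaces exchanged; it draws on the other direction of
    the equivalence of the \<open>phi_u\<close>.\<close>
  obtain CY where CY0: "0 \<le> CY"
    and CY: "\<And>D f g a b. finite D \<Longrightarrow> D \<noteq> {} \<Longrightarrow> qY f \<le> 1 \<Longrightarrow> qX g \<le> 1 \<Longrightarrow>
          a = (\<lambda>n. dual_basis scaleY qY y n f) \<Longrightarrow> b = (\<lambda>n. dual_basis scaleX qX x n g) \<Longrightarrow>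
          (\<And>i k. i \<in> D \<Longrightarrow> k \<notin> D \<Longrightarrow> norm (alt_coeffs a b k) \<le> norm (alt_coeffs a b i)) \<Longrightarrow>
          \<exists>A. greedy_set scaleY qY y f A \<and> card A \<le> card D \<and>
            qY (\<Sum>n\<in>(\<lambda>i. i div 2) ` D. scaleY (pair_coeff D a b n) (y n))
              \<le> CY * (1 + qY (coord_proj scaleY qY y A f))"
    by (rule diamond_greedy_component_le[OF assms(2,1,4,3) YX]) blast
  have upper: "?gZ m \<le> ennreal (2 * CX + 2 * CY) * ?g m" for m
  proof (cases "m = 0")
    case True
    then show ?thesis by (simp add: Z.g_param_0)
  next
    case False
    then have one: "1 \<le> ?g m" using X.one_le_g_param[OF X, of m] by (simp add: le_max_iff_disj)
    show ?thesis
    proof (rule Z.g_param_le)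
      fix D u assume D: "greedy_set ?s ?q ?z u D" "?q u \<le> 1" "card D \<le> m"
      obtain f g where u: "u = (f, g)" by (cases u)
      have fg: "qX f \<le> 1" "qY g \<le> 1" using D(2) by (simp_all add: u)
      define a where "a = (\<lambda>n. dual_basis scaleX qX x n f)"
      define b where "b = (\<lambda>n. dual_basis scaleY qY y n g)"
      have fin: "finite D" and ab: "\<And>i k. i \<in> D \<Longrightarrow> k \<notin> D \<Longrightarrow>
          norm (alt_coeffs a b k) \<le> norm (alt_coeffs a b i)"
        using D(1) unfolding u greedy_set_diamond_iff[OF X Y a_def b_def] by blast+
      show "ennreal (?q (coord_proj ?s ?q ?z D u)) \<le> ennreal (2 * CX + 2 * CY) * ?g m"
      proof (cases "D = {}")
        case True
        then show ?thesis by (simp add: coord_proj_def)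
      next
        case False
        obtain A where A: "greedy_set scaleX qX x f A" "card A \<le> card D"
          "qX (\<Sum>n\<in>(\<lambda>i. i div 2) ` D. scaleX (pair_coeff D a b n) (x n))
              \<le> CX * (1 + qX (coord_proj scaleX qX x A f))"
          using CX[OF fin False fg a_def b_def ab] by blast
        obtain B where B: "greedy_set scaleY qY y g B" "card B \<le> card D"
          "qY (\<Sum>n\<in>(\<lambda>i. i div 2) ` D. scaleY (pair_coeff D b a n) (y n))
              \<le> CY * (1 + qY (coord_proj scaleY qY y B g))"
          using CY[OF fin False fg(2,1) b_def a_def] ab
              by (simp add: norm_alt_coeffs_commute[of b a]) blast
        have "ennreal (qX (coord_proj scaleX qX x A f)) \<le> ?g m"
          by (rule order_trans[OF X.le_g_param[OF A(1) fg(1)] max.cobounded1]) (use A D in simp)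
        from ennreal_affine_le[OF A(3) CX0 X.q_nonneg this one]
        have "ennreal (qX (\<Sum>n\<in>(\<lambda>i. i div 2) ` D. scaleX (pair_coeff D a b n) (x n)))
            \<le> ennreal (2 * CX + 2 * CY) * ?g m"
          by (rule order_trans) (use CY0 in \<open>intro mult_right_mono ennreal_leI, auto\<close>)
        moreover have "ennreal (qY (coord_proj scaleY qY y B g)) \<le> ?g m"
          by (rule order_trans[OF Y.le_g_param[OF B(1) fg(2)] max.cobounded2]) (use B D in simp)
        from ennreal_affine_le[OF B(3) CY0 Y.q_nonneg this one]
        have "ennreal (qY (\<Sum>n\<in>(\<lambda>i. i div 2) ` D. scaleY (pair_coeff D b a n) (y n)))
            \<le> ennreal (2 * CX + 2 * CY) * ?g m"
          by (rule order_trans) (use CX0 in \<open>intro mult_right_mono ennreal_leI, auto\<close>)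
        ultimately show ?thesis
          unfolding u coord_proj_diamond[OF X Y fin a_def b_def] sum_qnorm_Pair
          by (auto simp only: max_def[of "qX _" "qY _"] split: if_split)
      qed
    qed
  qed

  obtain HX where HX0: "0 \<le> HX" and HX: "\<And>m G. 0 < m \<Longrightarrow> 1 \<le> G \<Longrightarrow>
      (\<And>A f. greedy_set scaleX qX x f A \<Longrightarrow> qX f \<le> 1 \<Longrightarrow> 2 * card A \<le> m \<Longrightarrow>
      ennreal (qX (coord_proj scaleX qX x A f)) \<le> G) \<Longrightarrow>
      ?gX m \<le> ennreal HX * G"
    by (rule X.g_param_le_of_halved[OF assms(3)]) blast
  obtain HY where HY0: "0 \<le> HY" and HY: "\<And>m G. 0 < m \<Longrightarrow> 1 \<le> G \<Longrightarrow>
      (\<And>A f. greedy_set scaleY qY y f A \<Longrightarrow> qY f \<le> 1 \<Longrightarrow> 2 * card A \<le> m \<Longrightarrow>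
      ennreal (qY (coord_proj scaleY qY y A f)) \<le> G) \<Longrightarrow>
      ?gY m \<le> ennreal HY * G"
    by (rule Y.g_param_le_of_halved[OF assms(4)]) blast
  have lower: "?g m \<le> ennreal (HX + HY) * ?gZ m" for m
  proof (cases "m = 0")
    case True
    then show ?thesis by (simp add: X.g_param_0 Y.g_param_0)
  next
    case False
    then have m: "0 < m" by simp
    have one: "1 \<le> ?gZ m" by (rule Z.one_le_g_param[OF Z m])
    \<comment> \<open>Halving is applied with \<open>G = ?gZ m\<close>: a greedy set of at most half
      the size can be doubled in the diamond without exceeding \<open>m\<close>.\<close>
    have "?gX m \<le> ennreal HX * ?gZ m" by (rule HX[OF m one le_g_param_diamond_left[OF X Y]])
    also have "\<dots> \<le> ennreal (HX + HY) * ?gZ m" using HY0 by (intro mult_right_mono ennreal_leI) auto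
    finally have 1: "?gX m \<le> ennreal (HX + HY) * ?gZ m" .
    have "?gY m \<le> ennreal HY * ?gZ m" by (rule HY[OF m one le_g_param_diamond_right[OF X Y]])
    also have "\<dots> \<le> ennreal (HX + HY) * ?gZ m" using HX0 by (intro mult_right_mono ennreal_leI) auto
    finally show ?thesis using 1 by simp
  qed

  \<comment> \<open>Dominations in both directions transfer finiteness, and since suprema commute
    with the maximum, finiteness for \<open>?g\<close> means finiteness for both bases.\<close>
  have "(SUP m. ?gZ m) < \<infinity> \<longleftrightarrow> (SUP m. ?g m) < \<infinity>"
    using SUP_ennreal_dominated_finite[of ?gZ _ ?g, OF upper]
      SUP_ennreal_dominated_finite[of ?g _ ?gZ, OF lower] by blast
  also have "(SUP m. ?g m) = max (SUP m. ?gX m) (SUP m. ?gY m)"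
    unfolding sup_max[symmetric] by (rule SUP_sup_distrib[symmetric]) simp_all
  finally have "quasi_greedy_basis ?s ?q ?z \<longleftrightarrow> quasi_greedy_basis scaleX qX x \<and> quasi_greedy_basis scaleY qY y"
    using X Y Z by (simp add: quasi_greedy_basis_def)
  with approx_equivI[of ?gZ _ ?g, OF upper lower] show ?thesis by blast
qed

end
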